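(* Let $\mathbb{K}$ be an algebraically closed field of characteristic zero, let $\mathfrak{g}$ be a Leibniz algebra over $\mathbb{K}$ such that $\gamma_2^{\mathrm{Lie}}(\mathfrak{g})\neq 0$ and $\Gamma^{\mathrm{Lie}}(\mathfrak{g})=\mathbb{K}\cdot\mathrm{Id}$, and let $R=\mathbb{K}[x_1,\dots,x_n]$. Then $\Gamma^{\mathrm{Lie}}(R\otimes\mathfrak{g})=R\otimes\Gamma^{\mathrm{Lie}}(\mathfrak{g})$.
   Context: Vector spaces and tensor products are over $\mathbb{K}$. A Leibniz algebra is a vector space $\mathfrak{g}$ with a bilinear map $[-,-]:\mathfrak{g}\times\mathfrak{g}\to\mathfrak{g}$ satisfying $[x,[y,z]]=[[x,y],z]-[[x,z],y]$ for all $x,y,z\in\mathfrak g$. Put $[x,y]_{\mathrm{Lie}}=[x,y]+[y,x]$. $\gamma_2^{\mathrm{Lie}}(\mathfrak{g})=[\mathfrak g,\mathfrak g]_{\mathrm{Lie}}$ is the two-sided ideal of $\mathfrak g$ generated by all $[x,y]_{\mathrm{Lie}}$, $x,y\in\mathfrak{g}$. The Lie-centroid $\Gamma^{\mathrm{Lie}}(\mathfrak{g})$ is the set of linear maps $d:\mathfrak{g}\to\mathfrak{g}$ with $d([x,y]_{\mathrm{Lie}})=[d(x),y]_{\mathrm{Lie}}=[x,d(y)]_{\mathrm{Lie}}$ for all $x,y\in\mathfrak g$. For a commutative associative algebra $A$, $A\otimes\mathfrak{g}$ is a Leibniz algebra with $[a_1\otimes g_1,a_2\otimes g_2]=(a_1a_2)\otimes[g_1,g_2]$.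 An element $r\otimes\varphi\in R\otimes\Gamma^{\mathrm{Lie}}(\mathfrak{g})$ is identified with the endomorphism $p\otimes g\mapsto rp\otimes\varphi(g)$ of $R\otimes\mathfrak{g}$. *)

theory Defs
  imports
    "HOL-Algebra.Algebraic_Closure_Type"
    "HOL-Library.Poly_Mapping"
begin

section \<open>Leibniz algebras\<close>

text \<open>
  The scalar field is a type, seen as a ring record through \<^const>\<open>ring_of_type_algebra\<close>.
  A (nonassociative) algebra over it is a record of type \<^typ>\<open>('k, 'g) module\<close> whose field
  \<^const>\<open>monoid.mult\<close> is the bilinear product; for a Leibniz algebra,
  \<open>x \<otimes>\<^bsub>G\<^esub> y\<close> is the bracket \<open>[x, y]\<close>. The field \<^const>\<open>monoid.one\<close> has no meaning there.
\<close>

locale leibniz_algebra = field K + module K G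
  for K :: "('k, 'm) ring_scheme" (structure) and G :: "('k, 'g, 'n) module_scheme" (structure) +
  assumes bracket_closed:
      "\<lbrakk>x \<in> carrier G; y \<in> carrier G\<rbrakk> \<Longrightarrow> x \<otimes>\<^bsub>G\<^esub> y \<in> carrier G"
    and bracket_add_left:
      "\<lbrakk>x \<in> carrier G; y \<in> carrier G; z \<in> carrier G\<rbrakk> \<Longrightarrow>
        (x \<oplus>\<^bsub>G\<^esub> y) \<otimes>\<^bsub>G\<^esub> z = x \<otimes>\<^bsub>G\<^esub> z \<oplus>\<^bsub>G\<^esub> y \<otimes>\<^bsub>G\<^esub> z"
    and bracket_add_right:
      "\<lbrakk>x \<in> carrier G; y \<in> carrier G; z \<in> carrier G\<rbrakk> \<Longrightarrow>
        x \<otimes>\<^bsub>G\<^esub> (y \<oplus>\<^bsub>G\<^esub> z) = x \<otimes>\<^bsub>G\<^esub> y \<oplus>\<^bsub>G\<^esub> x \<otimes>\<^bsub>G\<^esub> z"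
    and bracket_smult_left:
      "\<lbrakk>c \<in> carrier K; x \<in> carrier G; y \<in> carrier G\<rbrakk> \<Longrightarrow>
        (c \<odot>\<^bsub>G\<^esub> x) \<otimes>\<^bsub>G\<^esub> y = c \<odot>\<^bsub>G\<^esub> (x \<otimes>\<^bsub>G\<^esub> y)"
    and bracket_smult_right:
      "\<lbrakk>c \<in> carrier K; x \<in> carrier G; y \<in> carrier G\<rbrakk> \<Longrightarrow>
        x \<otimes>\<^bsub>G\<^esub> (c \<odot>\<^bsub>G\<^esub> y) = c \<odot>\<^bsub>G\<^esub> (x \<otimes>\<^bsub>G\<^esub> y)"
    and leibniz_identity:
      "\<lbrakk>x \<in> carrier G; y \<in> carrier G; z \<in> carrier G\<rbrakk> \<Longrightarrow>
        x \<otimes>\<^bsub>G\<^esub> (y \<otimes>\<^bsub>G\<^esub> z) = ((x \<otimes>\<^bsub>G\<^esub> y) \<otimes>\<^bsub>G\<^esub> z) \<ominus>\<^bsub>G\<^esub> ((x \<otimes>\<^bsub>G\<^esub> z) \<otimes>\<^bsub>G\<^esub> y)"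

definition lie_bracket :: "('k, 'g, 'n) module_scheme \<Rightarrow> 'g \<Rightarrow> 'g \<Rightarrow> 'g"
  where "lie_bracket G x y = x \<otimes>\<^bsub>G\<^esub> y \<oplus>\<^bsub>G\<^esub> y \<otimes>\<^bsub>G\<^esub> x"

definition leibniz_ideal ::
  "('k, 'm) ring_scheme \<Rightarrow> ('k, 'g, 'n) module_scheme \<Rightarrow> 'g set \<Rightarrow> bool"
  where "leibniz_ideal K G I \<longleftrightarrow>
    submodule I K G \<and>
    (\<forall>x\<in>carrier G. \<forall>y\<in>I. x \<otimes>\<^bsub>G\<^esub> y \<in> I \<and> y \<otimes>\<^bsub>G\<^esub> x \<in> I)"

definition gamma2_Lie :: "('k, 'm) ring_scheme \<Rightarrow> ('k, 'g, 'n) module_scheme \<Rightarrow> 'g set"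
  where "gamma2_Lie K G =
    \<Inter>{I. leibniz_ideal K G I \<and> (\<forall>x\<in>carrier G. \<forall>y\<in>carrier G. lie_bracket G x y \<in> I)}"

text \<open>
  Linear endomorphisms are taken to be extensional functions, so that they are determined by their
  values on the carrier.
\<close>

definition linear_endos ::
  "('k, 'm) ring_scheme \<Rightarrow> ('k, 'g, 'n) module_scheme \<Rightarrow> ('g \<Rightarrow> 'g) set"
  where "linear_endos K G =
    {d \<in> carrier G \<rightarrow>\<^sub>E carrier G.
      (\<forall>x\<in>carrier G. \<forall>y\<in>carrier G. d (x \<oplus>\<^bsub>G\<^esub> y) = d x \<oplus>\<^bsub>G\<^esub> d y) \<and>
      (\<forall>c\<in>carrier K. \<forall>x\<in>carrier G. d (c \<odot>\<^bsub>G\<^esub> x) = c \<odot>\<^bsub>G\<^esub> d x)}"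

definition lie_centroid ::
  "('k, 'm) ring_scheme \<Rightarrow> ('k, 'g, 'n) module_scheme \<Rightarrow> ('g \<Rightarrow> 'g) set"
  where "lie_centroid K G =
    {d \<in> linear_endos K G. \<forall>x\<in>carrier G. \<forall>y\<in>carrier G.
      d (lie_bracket G x y) = lie_bracket G (d x) y \<and>
      d (lie_bracket G x y) = lie_bracket G x (d y)}"

definition lie_centroid_module ::
  "('k, 'm) ring_scheme \<Rightarrow> ('k, 'g, 'n) module_scheme \<Rightarrow> ('k, 'g \<Rightarrow> 'g) module"
  where "lie_centroid_module K G =
    \<lparr> carrier = lie_centroid K G,
      monoid.mult = compose (carrier G),
      monoid.one = (\<lambda>x\<in>carrier G. x),
      ring.zero = (\<lambda>x\<in>carrier G. \<zero>\<^bsub>G\<^esub>),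
      add = (\<lambda>d e. \<lambda>x\<in>carrier G. d x \<oplus>\<^bsub>G\<^esub> e x),
      module.smult = (\<lambda>c d. \<lambda>x\<in>carrier G. c \<odot>\<^bsub>G\<^esub> d x) \<rparr>"


section \<open>Tensor products\<close>

text \<open>
  The tensor product of two vector spaces \<open>V\<close>, \<open>W\<close> over the field \<^typ>\<open>'k\<close> is the quotient of the
  free vector space on \<open>carrier V \<times> carrier W\<close> by the span of the bilinearity relations. A vector
  of the free space is a finitely supported function, and \<^term>\<open>Poly_Mapping.single (v, w) 1\<close> is
  the basis vector of the pair \<open>(v, w)\<close>.
\<close>

definition tensor_relations ::
  "('k::field, 'v, 'm) module_scheme \<Rightarrow> ('k, 'w, 'n) module_scheme \<Rightarrow> ('v \<times> 'w \<Rightarrow>\<^sub>0 'k) set"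
  where "tensor_relations V W =
    {Poly_Mapping.single (v \<oplus>\<^bsub>V\<^esub> v', w) 1 - Poly_Mapping.single (v, w) 1
        - Poly_Mapping.single (v', w) 1 | v v' w.
        v \<in> carrier V \<and> v' \<in> carrier V \<and> w \<in> carrier W} \<union>
    {Poly_Mapping.single (v, w \<oplus>\<^bsub>W\<^esub> w') 1 - Poly_Mapping.single (v, w) 1
        - Poly_Mapping.single (v, w') 1 | v w w'.
        v \<in> carrier V \<and> w \<in> carrier W \<and> w' \<in> carrier W} \<union>
    {Poly_Mapping.single (c \<odot>\<^bsub>V\<^esub> v, w) 1 - Poly_Mapping.single (v, w) c | c v w.
        v \<in> carrier V \<and> w \<in> carrier W} \<union>
    {Poly_Mapping.single (v, c \<odot>\<^bsub>W\<^esub> w) 1 - Poly_Mapping.single (v, w) c | c v w.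
        v \<in> carrier V \<and> w \<in> carrier W}"

definition tensor_kernel ::
  "('k::field, 'v, 'm) module_scheme \<Rightarrow> ('k, 'w, 'n) module_scheme \<Rightarrow> ('v \<times> 'w \<Rightarrow>\<^sub>0 'k) set"
  where "tensor_kernel V W =
    Modules.module.span (\<lambda>c. Poly_Mapping.map ((*) c)) (tensor_relations V W)"

definition tensor_class ::
  "('k::field, 'v, 'm) module_scheme \<Rightarrow> ('k, 'w, 'n) module_scheme \<Rightarrow>
    ('v \<times> 'w \<Rightarrow>\<^sub>0 'k) \<Rightarrow> ('v \<times> 'w \<Rightarrow>\<^sub>0 'k) set"
  where "tensor_class V W f = (\<lambda>h. f + h) ` tensor_kernel V W"

definition pure_tensor ::
  "('k::field, 'v, 'm) module_scheme \<Rightarrow> ('k, 'w, 'n) module_scheme \<Rightarrow>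
    'v \<Rightarrow> 'w \<Rightarrow> ('v \<times> 'w \<Rightarrow>\<^sub>0 'k) set"
  where "pure_tensor V W v w = tensor_class V W (Poly_Mapping.single (v, w) 1)"

text \<open>
  As a vector space only: the multiplicative fields of the record are left unspecified.
\<close>

definition tensor_module ::
  "('k::field, 'v, 'm) module_scheme \<Rightarrow> ('k, 'w, 'n) module_scheme \<Rightarrow>
    ('k, ('v \<times> 'w \<Rightarrow>\<^sub>0 'k) set) module"
  where "tensor_module V W =
    \<lparr> carrier = tensor_class V W ` {f. Poly_Mapping.keys f \<subseteq> carrier V \<times> carrier W},
      monoid.mult = undefined,
      monoid.one = undefined,
      ring.zero = tensor_class V W 0,
      add = (\<lambda>S T. \<Union>f\<in>S. \<Union>g\<in>T. tensor_class V W (f + g)),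
      module.smult = (\<lambda>c S. \<Union>f\<in>S. tensor_class V W (Poly_Mapping.map ((*) c) f)) \<rparr>"

text \<open>
  For a map \<open>b\<close> from \<open>carrier V \<times> carrier W\<close> to \<open>U\<close> that is bilinear, \<open>tensor_lift U b\<close> is the
  linear map from \<open>tensor_module V W\<close> to \<open>U\<close> sending \<open>pure_tensor V W v w\<close> to \<open>b v w\<close>: the linear
  extension of \<open>b\<close> to the free vector space is constant on each coset \<open>S\<close>.
\<close>

definition tensor_lift ::
  "('k::field, 'u, 'm) module_scheme \<Rightarrow> ('v \<Rightarrow> 'w \<Rightarrow> 'u) \<Rightarrow> ('v \<times> 'w \<Rightarrow>\<^sub>0 'k) set \<Rightarrow> 'u"
  where "tensor_lift U b S =
    the_elem ((\<lambda>f. \<Oplus>\<^bsub>U\<^esub>p\<in>Poly_Mapping.keys f.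
      Poly_Mapping.lookup f p \<odot>\<^bsub>U\<^esub> b (fst p) (snd p)) ` S)"

text \<open>
  The product is the bilinear one with
  \<open>(a\<^sub>1 \<otimes> g\<^sub>1) (a\<^sub>2 \<otimes> g\<^sub>2) = (a\<^sub>1 a\<^sub>2) \<otimes> (g\<^sub>1 g\<^sub>2)\<close>, where \<open>g\<^sub>1 g\<^sub>2\<close> is the bracket when \<open>G\<close> is a
  Leibniz algebra.
\<close>

definition tensor_algebra ::
  "('k::field, 'a, 'm) module_scheme \<Rightarrow> ('k, 'g, 'n) module_scheme \<Rightarrow>
    ('k, ('a \<times> 'g \<Rightarrow>\<^sub>0 'k) set) module"
  where "tensor_algebra A G =
    (tensor_module A G)\<lparr> monoid.mult := (\<lambda>S T.
      tensor_lift (tensor_module A G) (\<lambda>a\<^sub>1 g\<^sub>1.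
        tensor_lift (tensor_module A G) (\<lambda>a\<^sub>2 g\<^sub>2.
          pure_tensor A G (a\<^sub>1 \<otimes>\<^bsub>A\<^esub> a\<^sub>2) (g\<^sub>1 \<otimes>\<^bsub>G\<^esub> g\<^sub>2)) T) S) \<rparr>"

text \<open>
  The canonical map from the tensor product of \<open>A\<close> with a space of endomorphisms of \<open>G\<close> to the
  endomorphisms of \<open>A \<otimes> G\<close>; it sends \<open>r \<otimes> \<phi>\<close> to the map with \<open>p \<otimes> g \<mapsto> rp \<otimes> \<phi>(g)\<close>.
\<close>

definition tensor_endo ::
  "('k::field, 'a, 'm) module_scheme \<Rightarrow> ('k, 'g, 'n) module_scheme \<Rightarrow>
    ('a \<times> ('g \<Rightarrow> 'g) \<Rightarrow>\<^sub>0 'k) set \<Rightarrow> ('a \<times> 'g \<Rightarrow>\<^sub>0 'k) set \<Rightarrow> ('a \<times> 'g \<Rightarrow>\<^sub>0 'k) set"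
  where "tensor_endo A G Z = (\<lambda>S\<in>carrier (tensor_module A G).
    tensor_lift (tensor_module A G) (\<lambda>r \<phi>.
      tensor_lift (tensor_module A G) (\<lambda>p g. pure_tensor A G (r \<otimes>\<^bsub>A\<^esub> p) (\<phi> g)) S) Z)"


section \<open>Polynomial algebras\<close>

text \<open>
  Polynomials with coefficients in \<^typ>\<open>'k\<close> in variables indexed by the finite type \<^typ>\<open>'x\<close>:
  finitely supported functions on the monomials \<^typ>\<open>'x \<Rightarrow>\<^sub>0 nat\<close>, with the convolution product
  of \<^theory>\<open>HOL-Library.Poly_Mapping\<close>.
\<close>

definition polynomial_algebra :: "('k::field, ('x::finite \<Rightarrow>\<^sub>0 nat) \<Rightarrow>\<^sub>0 'k) module"
  where "polynomial_algebra =
    \<lparr> carrier = UNIV, monoid.mult = (*), one = 1, ring.zero = 0, add = (+),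
      module.smult = (\<lambda>c. Poly_Mapping.map ((*) c)) \<rparr>"

end

theory Submission
  imports Defs
begin

text \<open>
  Write \<open>[x, y]\<close> for the symmetrized bracket. Compare a map \<open>d\<close> in the Lie-centroid of \<open>R \<otimes> G\<close> with its coefficient maps: for a polynomial
  \<open>p\<close> and a monomial \<open>m\<close>, sending \<open>x\<close> to the coefficient of \<open>m\<close> in \<open>d (p \<otimes> x)\<close> is in the
  Lie-centroid of \<open>G\<close>, since \<open>p \<otimes> [x, y] = [p \<otimes> x, 1 \<otimes> y]\<close>, so it is a scalar. As \<open>G\<close> is nonzero,
  only finitely many of these scalars are nonzero, and \<open>d (p \<otimes> x) = q\<^sub>p \<otimes> x\<close> for a
  polynomial \<open>q\<^sub>p\<close>. Evaluating \<open>d\<close> at \<open>p \<otimes> [x, y] = [1 \<otimes> x, p \<otimes> y]\<close> with \<open>[x, y] \<noteq> 0\<close> gives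
  \<open>q\<^sub>p = q\<^sub>1 p\<close>, so \<open>d\<close> is multiplication by \<open>q\<^sub>1\<close>.
\<close>

section \<open>Vector spaces and linear maps\<close>

text \<open>The carrier of the scalar ring is the whole type \<open>'k\<close>, so the module laws
  are restated below with type-class operations on scalars and without carrier premises for
  them.\<close>

locale vspace = module ring_of_type_algebra V
  for V :: "('k::field, 'v, 'm) module_scheme" (structure)
begin

lemma scale_closed [simp, intro]: "x \<in> carrier V \<Longrightarrow> c \<odot> x \<in> carrier V"
  using smult_closed[of c x] by (simp add: ring_of_type_algebra_def)

lemma scale_add_left: "x \<in> carrier V \<Longrightarrow> (a + b) \<odot> x = a \<odot> x \<oplus> b \<odot> x"
  using smult_l_distr[of a b x] by (simp add: ring_of_type_algebra_def)

lemma scale_add_right: "x \<in> carrier V \<Longrightarrow> y \<in> carrier V \<Longrightarrow> a \<odot> (x \<oplus> y) = a \<odot> x \<oplus> a \<odot> y"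
  using smult_r_distr[of a x y] by (simp add: ring_of_type_algebra_def)

lemma scale_scale: "x \<in> carrier V \<Longrightarrow> a \<odot> (b \<odot> x) = (a * b) \<odot> x"
  using smult_assoc1[of a b x] by (simp add: ring_of_type_algebra_def)

lemma scale_one [simp]: "x \<in> carrier V \<Longrightarrow> 1 \<odot> x = x"
  using smult_one[of x] by (simp add: ring_of_type_algebra_def)

lemma scale_zero_left [simp]: "x \<in> carrier V \<Longrightarrow> 0 \<odot> x = \<zero>"
  using smult_l_null[of x] by (simp add: ring_of_type_algebra_def)

lemma scale_zero_right [simp]: "a \<odot> \<zero> = \<zero>"
  using smult_r_null[of a] by (simp add: ring_of_type_algebra_def)

lemma scale_eq_zero_iff: "x \<in> carrier V \<Longrightarrow> a \<odot> x = \<zero> \<longleftrightarrow> a = 0 \<or> x = \<zero>"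
proof (intro iffI; (elim disjE)?)
  assume x: "x \<in> carrier V" and "a \<odot> x = \<zero>"
  then have "(inverse a * a) \<odot> x = \<zero>"
    by (simp flip: scale_scale)
  then show "a = 0 \<or> x = \<zero>"
    using x by (cases "a = 0") auto
qed auto

lemma scale_cancel:
  assumes x: "x \<in> carrier V" "x \<noteq> \<zero>" and eq: "a \<odot> x = b \<odot> x"
  shows "a = b"
proof -
  have "(a - b) \<odot> x \<oplus> b \<odot> x = \<zero> \<oplus> b \<odot> x"
    using x eq by (simp flip: scale_add_left)
  then show ?thesis
    using x by (simp add: scale_eq_zero_iff)
qed

lemma finsum_scale:
  "finite A \<Longrightarrow> f \<in> A \<rightarrow> carrier V \<Longrightarrow> a \<odot> (\<Oplus>i\<in>A. f i) = (\<Oplus>i\<in>A. a \<odot> f i)"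
  using finsum_smult_ldistr[of A a f] by (simp add: ring_of_type_algebra_def)

end

text \<open>Additive inverses are not among the premises: (-1) x serves as the inverse of x, by
  \<open>scale_add_left\<close> and \<open>scale_zero\<close>.\<close>

lemma vspaceI:
  fixes V :: "('k::field, 'v, 'm) module_scheme" (structure)
  assumes zero: "\<zero> \<in> carrier V"
    and add: "\<And>x y. x \<in> carrier V \<Longrightarrow> y \<in> carrier V \<Longrightarrow> x \<oplus> y \<in> carrier V"
    and assoc: "\<And>x y z. x \<in> carrier V \<Longrightarrow> y \<in> carrier V \<Longrightarrow> z \<in> carrier V \<Longrightarrow>
      x \<oplus> y \<oplus> z = x \<oplus> (y \<oplus> z)"
    and comm: "\<And>x y. x \<in> carrier V \<Longrightarrow> y \<in> carrier V \<Longrightarrow> x \<oplus> y = y \<oplus> x"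
    and zero_add: "\<And>x. x \<in> carrier V \<Longrightarrow> \<zero> \<oplus> x = x"
    and scale: "\<And>c x. x \<in> carrier V \<Longrightarrow> c \<odot> x \<in> carrier V"
    and scale_add_left: "\<And>a b x. x \<in> carrier V \<Longrightarrow> (a + b) \<odot> x = a \<odot> x \<oplus> b \<odot> x"
    and scale_add_right: "\<And>a x y. x \<in> carrier V \<Longrightarrow> y \<in> carrier V \<Longrightarrow>
      a \<odot> (x \<oplus> y) = a \<odot> x \<oplus> a \<odot> y"
    and scale_scale: "\<And>a b x. x \<in> carrier V \<Longrightarrow> a \<odot> (b \<odot> x) = (a * b) \<odot> x"
    and scale_one: "\<And>x. x \<in> carrier V \<Longrightarrow> 1 \<odot> x = x"
    and scale_zero: "\<And>x. x \<in> carrier V \<Longrightarrow> 0 \<odot> x = \<zero>"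
  shows "vspace V"
  unfolding vspace_def
proof (rule moduleI)
  show "cring (ring_of_type_algebra :: 'k ring)"
    by (rule cring_from_type_algebra)
  show "abelian_group V"
  proof (rule abelian_groupI)
    fix x assume x: "x \<in> carrier V"
    have "(- 1) \<odot> x \<oplus> x = (- 1) \<odot> x \<oplus> 1 \<odot> x"
      using x by (simp add: scale_one)
    also have "\<dots> = (- 1 + 1) \<odot> x"
      using x by (rule scale_add_left[symmetric])
    also have "\<dots> = \<zero>"
      using x by (simp add: scale_zero)
    finally show "\<exists>y\<in>carrier V. y \<oplus> x = \<zero>"
      using x scale by (intro bexI)
  qed (fact zero add assoc comm zero_add)+
qed (simp_all add: ring_of_type_algebra_def scale scale_add_left scale_add_right scale_scale scale_one)

section \<open>Linear and bilinear maps, with no condition off the carrier\<close>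

definition linear_map ::
  "('k, 'v, 'm) module_scheme \<Rightarrow> ('k, 'u, 'n) module_scheme \<Rightarrow> ('v \<Rightarrow> 'u) \<Rightarrow> bool"
  where "linear_map V U f \<longleftrightarrow>
    (\<forall>x\<in>carrier V. f x \<in> carrier U) \<and>
    (\<forall>x\<in>carrier V. \<forall>y\<in>carrier V. f (x \<oplus>\<^bsub>V\<^esub> y) = f x \<oplus>\<^bsub>U\<^esub> f y) \<and>
    (\<forall>c. \<forall>x\<in>carrier V. f (c \<odot>\<^bsub>V\<^esub> x) = c \<odot>\<^bsub>U\<^esub> f x)"

definition bilinear_map ::
  "('k, 'v, 'm) module_scheme \<Rightarrow> ('k, 'w, 'n) module_scheme \<Rightarrow> ('k, 'u, 'l) module_scheme \<Rightarrow>
    ('v \<Rightarrow> 'w \<Rightarrow> 'u) \<Rightarrow> bool"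
  where "bilinear_map V W U b \<longleftrightarrow>
    (\<forall>v\<in>carrier V. linear_map W U (b v)) \<and> (\<forall>w\<in>carrier W. linear_map V U (\<lambda>v. b v w))"

lemma linear_mapI:
  assumes "\<And>x. x \<in> carrier V \<Longrightarrow> f x \<in> carrier U"
    and "\<And>x y. x \<in> carrier V \<Longrightarrow> y \<in> carrier V \<Longrightarrow> f (x \<oplus>\<^bsub>V\<^esub> y) = f x \<oplus>\<^bsub>U\<^esub> f y"
    and "\<And>c x. x \<in> carrier V \<Longrightarrow> f (c \<odot>\<^bsub>V\<^esub> x) = c \<odot>\<^bsub>U\<^esub> f x"
  shows "linear_map V U f"
  using assms by (simp add: linear_map_def)

lemma linear_mapD:
  assumes "linear_map V U f"
  shows "x \<in> carrier V \<Longrightarrow> f x \<in> carrier U"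
    and "x \<in> carrier V \<Longrightarrow> y \<in> carrier V \<Longrightarrow> f (x \<oplus>\<^bsub>V\<^esub> y) = f x \<oplus>\<^bsub>U\<^esub> f y"
    and "x \<in> carrier V \<Longrightarrow> f (c \<odot>\<^bsub>V\<^esub> x) = c \<odot>\<^bsub>U\<^esub> f x"
  using assms by (simp_all add: linear_map_def)

lemma bilinear_mapI:
  assumes "\<And>v. v \<in> carrier V \<Longrightarrow> linear_map W U (b v)"
    and "\<And>w. w \<in> carrier W \<Longrightarrow> linear_map V U (\<lambda>v. b v w)"
  shows "bilinear_map V W U b"
  using assms by (simp add: bilinear_map_def)

lemma bilinear_mapD:
  assumes "bilinear_map V W U b"
  shows "v \<in> carrier V \<Longrightarrow> linear_map W U (b v)"
    and "w \<in> carrier W \<Longrightarrow> linear_map V U (\<lambda>v. b v w)"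
    and "v \<in> carrier V \<Longrightarrow> w \<in> carrier W \<Longrightarrow> b v w \<in> carrier U"
  using assms by (simp_all add: bilinear_map_def linear_map_def)

lemma linear_map_comp:
  assumes "linear_map V U f" "linear_map U W g"
  shows "linear_map V W (\<lambda>x. g (f x))"
  using assms by (simp add: linear_map_def)

lemma linear_map_add:
  assumes "vspace U" "linear_map V U f" "linear_map V U g"
  shows "linear_map V U (\<lambda>x. f x \<oplus>\<^bsub>U\<^esub> g x)"
proof -
  interpret U: vspace U by fact
  show ?thesis
    using assms(2,3) by (simp add: linear_map_def U.scale_add_right U.a_ac)
qed

lemma linear_map_scale:
  assumes "vspace U" "linear_map V U f"
  shows "linear_map V U (\<lambda>x. c \<odot>\<^bsub>U\<^esub> f x)"
proof -
  interpret U: vspace U by fact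
  show ?thesis
    using assms(2) by (simp add: linear_map_def U.scale_add_right U.scale_scale mult.commute)
qed

lemma linear_map_zero:
  assumes "vspace V" "vspace U" "linear_map V U f"
  shows "f \<zero>\<^bsub>V\<^esub> = \<zero>\<^bsub>U\<^esub>"
proof -
  interpret V: vspace V by fact
  interpret U: vspace U by fact
  have "f (0 \<odot>\<^bsub>V\<^esub> \<zero>\<^bsub>V\<^esub>) = 0 \<odot>\<^bsub>U\<^esub> f \<zero>\<^bsub>V\<^esub>"
    by (rule linear_mapD(3)[OF assms(3)]) simp
  then show ?thesis
    using linear_mapD(1)[OF assms(3)] by simp
qed

section \<open>Tensor products\<close>

lemma lookup_scale [simp]:
  "Poly_Mapping.lookup (Poly_Mapping.map ((*) c) f) p = (c :: 'k::field) * Poly_Mapping.lookup f p"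
  by (simp add: Poly_Mapping.map.rep_eq when_def)

lemma scale_single [simp]:
  "Poly_Mapping.map ((*) c) (Poly_Mapping.single p a) = Poly_Mapping.single p (c * a :: 'k::field)"
  by (rule poly_mapping_eqI) (simp add: lookup_single when_def)

interpretation free: Modules.module "\<lambda>c. Poly_Mapping.map ((*) (c :: 'k::field))"
  by standard (auto intro!: poly_mapping_eqI simp: lookup_add algebra_simps)

lemma keys_scale_subset:
  "Poly_Mapping.keys f \<subseteq> A \<Longrightarrow> Poly_Mapping.keys (Poly_Mapping.map ((*) (c :: 'k::field)) f) \<subseteq> A"
  by (auto simp: in_keys_iff)

lemma keys_add_subset:
  "Poly_Mapping.keys f \<subseteq> A \<Longrightarrow> Poly_Mapping.keys g \<subseteq> A \<Longrightarrow> Poly_Mapping.keys (f + g) \<subseteq> A"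
  using Poly_Mapping.keys_add[of f g] by blast

section \<open>The tensor product as a quotient vector space\<close>

lemma tensor_kernel_eq_span: "tensor_kernel V W = free.span (tensor_relations V W)"
  by (simp add: tensor_kernel_def)

lemma tensor_class_eq_iff:
  "tensor_class V W f = tensor_class V W g \<longleftrightarrow> f - g \<in> tensor_kernel V W"
proof
  assume "tensor_class V W f = tensor_class V W g"
  moreover have "f \<in> tensor_class V W f"
    using free.span_zero by (force simp: tensor_class_def tensor_kernel_eq_span)
  ultimately obtain h where "h \<in> tensor_kernel V W" "f = g + h"
    by (auto simp: tensor_class_def)
  then show "f - g \<in> tensor_kernel V W"
    by simp
next
  assume d: "f - g \<in> tensor_kernel V W"
  have "tensor_class V W f \<subseteq> tensor_class V W g" if "f - g \<in> tensor_kernel V W" for f g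
  proof
    fix x assume "x \<in> tensor_class V W f"
    then obtain h where h: "h \<in> tensor_kernel V W" "x = f + h"
      by (auto simp: tensor_class_def)
    then have "x = g + ((f - g) + h)" "(f - g) + h \<in> tensor_kernel V W"
      using that by (simp_all add: tensor_kernel_eq_span free.span_add)
    then show "x \<in> tensor_class V W g"
      unfolding tensor_class_def by blast
  qed
  moreover have "g - f \<in> tensor_kernel V W"
    using free.span_neg[of "f - g"] d by (simp add: tensor_kernel_eq_span)
  ultimately show "tensor_class V W f = tensor_class V W g"
    using d by blast
qed

lemma mem_tensor_class_iff: "g \<in> tensor_class V W f \<longleftrightarrow> tensor_class V W g = tensor_class V W f"
proof -
  have "g \<in> tensor_class V W f \<longleftrightarrow> g - f \<in> tensor_kernel V W"
    by (force simp: tensor_class_def image_iff)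
  then show ?thesis
    by (simp add: tensor_class_eq_iff)
qed

lemma tensor_class_self: "f \<in> tensor_class V W f"
  by (simp add: mem_tensor_class_iff)

text \<open>The record adds cosets by a union over all pairs of representatives. The kernel is
  closed under addition, so every set in that union is the same coset.\<close>

lemma tensor_class_add [simp]:
  "tensor_class V W f \<oplus>\<^bsub>tensor_module V W\<^esub> tensor_class V W g = tensor_class V W (f + g)"
proof -
  have "tensor_class V W (f' + g') = tensor_class V W (f + g)"
    if "f' \<in> tensor_class V W f" "g' \<in> tensor_class V W g" for f' g'
    using that free.span_add[of "f' - f" "tensor_relations V W" "g' - g"]
    by (simp add: mem_tensor_class_iff tensor_class_eq_iff tensor_kernel_eq_span algebra_simps)
  then have "(\<Union>f'\<in>tensor_class V W f. \<Union>g'\<in>tensor_class V W g. tensor_class V W (f' + g'))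
      = tensor_class V W (f + g)"
    using tensor_class_self[of f V W] tensor_class_self[of g V W] by blast
  then show ?thesis
    by (simp add: tensor_module_def)
qed

lemma tensor_class_scale [simp]:
  "c \<odot>\<^bsub>tensor_module V W\<^esub> tensor_class V W f = tensor_class V W (Poly_Mapping.map ((*) c) f)"
proof -
  have "tensor_class V W (Poly_Mapping.map ((*) c) f') = tensor_class V W (Poly_Mapping.map ((*) c) f)"
    if "f' \<in> tensor_class V W f" for f'
    using that free.span_scale[of "f' - f" "tensor_relations V W" c]
    by (simp add: mem_tensor_class_iff tensor_class_eq_iff tensor_kernel_eq_span
        free.scale_right_diff_distrib)
  then have "(\<Union>f'\<in>tensor_class V W f. tensor_class V W (Poly_Mapping.map ((*) c) f'))
      = tensor_class V W (Poly_Mapping.map ((*) c) f)"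
    using tensor_class_self[of f V W] by blast
  then show ?thesis
    by (simp add: tensor_module_def)
qed

lemma tensor_carrierE:
  assumes "S \<in> carrier (tensor_module V W)"
  obtains f where "S = tensor_class V W f" "Poly_Mapping.keys f \<subseteq> carrier V \<times> carrier W"
  using assms by (auto simp: tensor_module_def)

lemma tensor_class_closed:
  "Poly_Mapping.keys f \<subseteq> carrier V \<times> carrier W \<Longrightarrow> tensor_class V W f \<in> carrier (tensor_module V W)"
  by (auto simp: tensor_module_def)

lemma zero_tensor_module: "\<zero>\<^bsub>tensor_module V W\<^esub> = tensor_class V W 0"
  by (simp add: tensor_module_def)

text \<open>Once representatives are chosen, each law is the corresponding law of the free vector
  space.\<close>

lemma vspace_tensor_module: "vspace (tensor_module V W)"
proof (rule vspaceI; (elim tensor_carrierE)?)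
  show "\<zero>\<^bsub>tensor_module V W\<^esub> \<in> carrier (tensor_module V W)"
    by (simp add: zero_tensor_module tensor_class_closed)
next
  fix x y f g
  assume f: "x = tensor_class V W f" "Poly_Mapping.keys f \<subseteq> carrier V \<times> carrier W"
  then show "c \<odot>\<^bsub>tensor_module V W\<^esub> x \<in> carrier (tensor_module V W)" for c
    by (simp add: tensor_class_closed keys_scale_subset)
  assume "y = tensor_class V W g" "Poly_Mapping.keys g \<subseteq> carrier V \<times> carrier W"
  with f show "x \<oplus>\<^bsub>tensor_module V W\<^esub> y \<in> carrier (tensor_module V W)"
    by (simp add: tensor_class_closed keys_add_subset)
qed (simp_all add: zero_tensor_module ac_simps free.scale_left_distrib free.scale_right_distrib)

text \<open>The linear extension of \<open>b\<close> to the free vector space: the function whose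
  single value on a coset \<open>tensor_lift\<close> picks out.\<close>

definition free_lift ::
  "('k::field, 'u, 'm) module_scheme \<Rightarrow> ('v \<Rightarrow> 'w \<Rightarrow> 'u) \<Rightarrow> ('v \<times> 'w \<Rightarrow>\<^sub>0 'k) \<Rightarrow> 'u"
  where "free_lift U b f = (\<Oplus>\<^bsub>U\<^esub>p\<in>Poly_Mapping.keys f.
      Poly_Mapping.lookup f p \<odot>\<^bsub>U\<^esub> b (fst p) (snd p))"

lemma pure_tensor_closed [simp, intro]:
  "v \<in> carrier V \<Longrightarrow> w \<in> carrier W \<Longrightarrow> pure_tensor V W v w \<in> carrier (tensor_module V W)"
  unfolding pure_tensor_def by (rule tensor_class_closed) simp

text \<open>Each of the four laws says that one family in \<open>tensor_relations\<close> lies in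
  the kernel.\<close>

lemma bilinear_pure_tensor: "bilinear_map V W (tensor_module V W) (pure_tensor V W)"
proof -
  have "pure_tensor V W (v \<oplus>\<^bsub>V\<^esub> v') w =
      pure_tensor V W v w \<oplus>\<^bsub>tensor_module V W\<^esub> pure_tensor V W v' w"
    if "v \<in> carrier V" "v' \<in> carrier V" "w \<in> carrier W" for v v' w
    using that unfolding pure_tensor_def tensor_class_add tensor_class_eq_iff tensor_kernel_eq_span
    by (intro free.span_base) (simp only: tensor_relations_def diff_diff_eq, blast)
  moreover have "pure_tensor V W v (w \<oplus>\<^bsub>W\<^esub> w') =
      pure_tensor V W v w \<oplus>\<^bsub>tensor_module V W\<^esub> pure_tensor V W v w'"
    if "v \<in> carrier V" "w' \<in> carrier W" "w \<in> carrier W" for v w w'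
    using that unfolding pure_tensor_def tensor_class_add tensor_class_eq_iff tensor_kernel_eq_span
    by (intro free.span_base) (simp only: tensor_relations_def diff_diff_eq, blast)
  moreover have "pure_tensor V W (c \<odot>\<^bsub>V\<^esub> v) w = c \<odot>\<^bsub>tensor_module V W\<^esub> pure_tensor V W v w"
    if "v \<in> carrier V" "w \<in> carrier W" for c v w
    using that unfolding pure_tensor_def tensor_class_scale tensor_class_eq_iff tensor_kernel_eq_span
    by (intro free.span_base) (simp add: tensor_relations_def, blast)
  moreover have "pure_tensor V W v (c \<odot>\<^bsub>W\<^esub> w) = c \<odot>\<^bsub>tensor_module V W\<^esub> pure_tensor V W v w"
    if "v \<in> carrier V" "w \<in> carrier W" for c v w
    using that unfolding pure_tensor_def tensor_class_scale tensor_class_eq_iff tensor_kernel_eq_span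
    by (intro free.span_base) (simp add: tensor_relations_def, blast)
  ultimately show ?thesis
    by (intro bilinear_mapI linear_mapI) auto
qed

lemmas linear_pure_tensor_right = bilinear_mapD(1)[OF bilinear_pure_tensor]
  and linear_pure_tensor_left = bilinear_mapD(2)[OF bilinear_pure_tensor]

text \<open>Setting the value at a fresh key amounts to adding a single term, so this follows from
  \<open>update_induct\<close>; the set \<open>A\<close> keeps the keys inside the carriers.\<close>

lemma single_plus_induct [consumes 1, case_names zero single_plus]:
  assumes "Poly_Mapping.keys f \<subseteq> A"
    and "P 0"
    and "\<And>p c f. p \<in> A \<Longrightarrow> Poly_Mapping.keys f \<subseteq> A \<Longrightarrow> P f \<Longrightarrow> P (Poly_Mapping.single p c + f)"
  shows "P (f :: 'a \<Rightarrow>\<^sub>0 'b::comm_monoid_add)"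
  using assms(1)
proof (induction f rule: update_induct)
  case const
  show ?case by (rule assms)
next
  case (update f a b)
  have "Poly_Mapping.update a b f = Poly_Mapping.single a b + f"
    using update(1) by (auto intro!: poly_mapping_eqI
        simp: Poly_Mapping.lookup_update lookup_add lookup_single when_def in_keys_iff)
  moreover have "Poly_Mapping.keys (Poly_Mapping.update a b f) = insert a (Poly_Mapping.keys f)"
    using update(2) by (simp add: keys_update)
  ultimately show ?case
    using update assms(3)[of a f b] by simp
qed

text \<open>Neither zero nor scaling needs a case of its own: zero is the pure tensor of the two
  zeros, and a scalar is absorbed into the left factor.\<close>

lemma tensor_induct [consumes 3, case_names pure add]:
  assumes S: "S \<in> carrier (tensor_module V W)"
    and V: "vspace V" and W: "vspace W"
    and pure: "\<And>v w. v \<in> carrier V \<Longrightarrow> w \<in> carrier W \<Longrightarrow> P (pure_tensor V W v w)"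
    and add: "\<And>S T. S \<in> carrier (tensor_module V W) \<Longrightarrow> T \<in> carrier (tensor_module V W) \<Longrightarrow>
      P S \<Longrightarrow> P T \<Longrightarrow> P (S \<oplus>\<^bsub>tensor_module V W\<^esub> T)"
  shows "P S"
proof -
  interpret V: vspace V by fact
  interpret W: vspace W by fact
  obtain f where f: "S = tensor_class V W f" "Poly_Mapping.keys f \<subseteq> carrier V \<times> carrier W"
    using S by (rule tensor_carrierE)
  from f(2) have "P (tensor_class V W f)"
  proof (induction f rule: single_plus_induct)
    case zero
    have "pure_tensor V W \<zero>\<^bsub>V\<^esub> \<zero>\<^bsub>W\<^esub> = tensor_class V W 0"
      using linear_map_zero[OF V vspace_tensor_module linear_pure_tensor_left[OF W.zero_closed]]
      by (simp add: zero_tensor_module)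
    then show ?case
      using pure[OF V.zero_closed W.zero_closed] by simp
  next
    case (single_plus p c f)
    obtain v w where p: "p = (v, w)" "v \<in> carrier V" "w \<in> carrier W"
      using single_plus(1) by auto
    have "pure_tensor V W (c \<odot>\<^bsub>V\<^esub> v) w = tensor_class V W (Poly_Mapping.single p c)"
      using linear_mapD(3)[OF linear_pure_tensor_left[of w W V] p(2), of c] p
      by (simp add: pure_tensor_def)
    then have "P (tensor_class V W (Poly_Mapping.single p c))"
      using pure[of "c \<odot>\<^bsub>V\<^esub> v" w] p by simp
    then show ?case
      using add[of "tensor_class V W (Poly_Mapping.single p c)" "tensor_class V W f"]
        single_plus by (simp add: tensor_class_closed)
  qed
  then show ?thesis
    by (simp add: f)
qed

lemma tensor_linear_map_eqI:
  assumes "linear_map (tensor_module V W) U f" "linear_map (tensor_module V W) U g"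
    and V: "vspace V" "vspace W"
    and "\<And>v w. v \<in> carrier V \<Longrightarrow> w \<in> carrier W \<Longrightarrow>
      f (pure_tensor V W v w) = g (pure_tensor V W v w)"
    and S: "S \<in> carrier (tensor_module V W)"
  shows "f S = g S"
  using S V by (induction S rule: tensor_induct)
    (simp_all add: assms(5) linear_mapD(2)[OF assms(1)] linear_mapD(2)[OF assms(2)])

section \<open>Linear extension to the free vector space and its descent to the quotient\<close>

context
  fixes V :: "('k::field, 'v, 'm) module_scheme" and W :: "('k, 'w, 'n) module_scheme"
    and U :: "('k, 'u, 'l) module_scheme" and b
  assumes U: "vspace U"
    and b_closed: "\<And>v w. v \<in> carrier V \<Longrightarrow> w \<in> carrier W \<Longrightarrow> b v w \<in> carrier U"
begin

interpretation U: vspace U by (rule U)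

text \<open>Enlarging the index set adds only zero terms. This lets two free vectors be summed over
  a common index set.\<close>

lemma free_lift_superset:
  assumes "Poly_Mapping.keys f \<subseteq> A" "finite A" "A \<subseteq> carrier V \<times> carrier W"
  shows "free_lift U b f = (\<Oplus>\<^bsub>U\<^esub>p\<in>A. Poly_Mapping.lookup f p \<odot>\<^bsub>U\<^esub> b (fst p) (snd p))"
  unfolding free_lift_def using assms b_closed
  by (intro U.add.finprod_mono_neutral_cong_left) (auto simp: in_keys_iff subset_iff)

lemma free_lift_closed:
  "Poly_Mapping.keys f \<subseteq> carrier V \<times> carrier W \<Longrightarrow> free_lift U b f \<in> carrier U"
  unfolding free_lift_def using b_closed by (intro U.finsum_closed) auto

lemma free_lift_add:
  assumes "Poly_Mapping.keys f \<subseteq> carrier V \<times> carrier W" "Poly_Mapping.keys g \<subseteq> carrier V \<times> carrier W"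
  shows "free_lift U b (f + g) = free_lift U b f \<oplus>\<^bsub>U\<^esub> free_lift U b g"
proof -
  let ?A = "Poly_Mapping.keys f \<union> Poly_Mapping.keys g"
  have A: "finite ?A" "?A \<subseteq> carrier V \<times> carrier W"
    using assms by auto
  have "free_lift U b (f + g) =
      (\<Oplus>\<^bsub>U\<^esub>p\<in>?A. Poly_Mapping.lookup (f + g) p \<odot>\<^bsub>U\<^esub> b (fst p) (snd p))"
    using A by (intro free_lift_superset keys_add_subset) auto
  also have "\<dots> = (\<Oplus>\<^bsub>U\<^esub>p\<in>?A. Poly_Mapping.lookup f p \<odot>\<^bsub>U\<^esub> b (fst p) (snd p) \<oplus>\<^bsub>U\<^esub>
      Poly_Mapping.lookup g p \<odot>\<^bsub>U\<^esub> b (fst p) (snd p))"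
    using A b_closed by (intro U.finsum_cong') (auto simp: lookup_add U.scale_add_left)
  also have "\<dots> = free_lift U b f \<oplus>\<^bsub>U\<^esub> free_lift U b g"
    using A b_closed by (subst U.finsum_addf) (auto simp: free_lift_superset[of _ ?A])
  finally show ?thesis .
qed

lemma free_lift_scale:
  assumes "Poly_Mapping.keys f \<subseteq> carrier V \<times> carrier W"
  shows "free_lift U b (Poly_Mapping.map ((*) c) f) = c \<odot>\<^bsub>U\<^esub> free_lift U b f"
proof -
  let ?A = "Poly_Mapping.keys f"
  have "free_lift U b (Poly_Mapping.map ((*) c) f) =
      (\<Oplus>\<^bsub>U\<^esub>p\<in>?A. Poly_Mapping.lookup (Poly_Mapping.map ((*) c) f) p \<odot>\<^bsub>U\<^esub> b (fst p) (snd p))"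
    using assms by (intro free_lift_superset keys_scale_subset) auto
  also have "\<dots> = (\<Oplus>\<^bsub>U\<^esub>p\<in>?A. c \<odot>\<^bsub>U\<^esub> (Poly_Mapping.lookup f p \<odot>\<^bsub>U\<^esub> b (fst p) (snd p)))"
    using assms b_closed by (intro U.finsum_cong') (auto simp: U.scale_scale)
  also have "\<dots> = c \<odot>\<^bsub>U\<^esub> free_lift U b f"
    unfolding free_lift_def using assms b_closed by (intro U.finsum_scale[symmetric]) auto
  finally show ?thesis .
qed

lemma free_lift_single:
  "v \<in> carrier V \<Longrightarrow> w \<in> carrier W \<Longrightarrow> free_lift U b (Poly_Mapping.single (v, w) c) = c \<odot>\<^bsub>U\<^esub> b v w"
  using free_lift_superset[of "Poly_Mapping.single (v, w) c" "{(v, w)}"] b_closed by simp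

text \<open>The value at f is the value at f - g plus the value at g, and the latter cancels. It
  turns a bilinearity law for \<open>b\<close> into the vanishing of the extension on a
  relation.\<close>

lemma free_lift_diff_eq_zero:
  assumes "Poly_Mapping.keys f \<subseteq> carrier V \<times> carrier W" "Poly_Mapping.keys g \<subseteq> carrier V \<times> carrier W"
    and "free_lift U b f = free_lift U b g"
  shows "free_lift U b (f - g) = \<zero>\<^bsub>U\<^esub>"
proof -
  have "Poly_Mapping.keys (f - g) \<subseteq> carrier V \<times> carrier W"
    using keys_diff[of f g] assms by blast
  moreover from this have "free_lift U b ((f - g) + g) = free_lift U b (f - g) \<oplus>\<^bsub>U\<^esub> free_lift U b g"
    using assms by (intro free_lift_add)
  ultimately show ?thesis
    using assms free_lift_closed by simp
qed

end

text \<open>The vectors with the stated property form a subspace containing the relations, hence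
  their span. The bound on the keys is part of the induction because additivity of
  \<open>free_lift\<close> is available only for keys inside the carriers.\<close>

lemma free_lift_tensor_kernel:
  assumes V: "vspace V" and W: "vspace W" and U: "vspace U" and b: "bilinear_map V W U b"
    and h: "h \<in> tensor_kernel V W"
  shows "Poly_Mapping.keys h \<subseteq> carrier V \<times> carrier W \<and> free_lift U b h = \<zero>\<^bsub>U\<^esub>"
proof -
  interpret V: vspace V by fact
  interpret W: vspace W by fact
  interpret U: vspace U by fact
  note closed = bilinear_mapD(3)[OF b]
  note free = free_lift_add[of U V W b, OF U closed] free_lift_scale[of U V W b, OF U closed]
    free_lift_single[of U V W b, OF U closed]
  let ?P = "\<lambda>h. Poly_Mapping.keys h \<subseteq> carrier V \<times> carrier W \<and> free_lift U b h = \<zero>\<^bsub>U\<^esub>"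
  have diff: "?P (f - g)"
    if "Poly_Mapping.keys f \<subseteq> carrier V \<times> carrier W" "Poly_Mapping.keys g \<subseteq> carrier V \<times> carrier W"
      "free_lift U b f = free_lift U b g" for f g
    using free_lift_diff_eq_zero[of U V W b, OF U closed] that keys_diff[of f g] by blast
  from h show ?thesis
    unfolding tensor_kernel_eq_span
  proof (induction h rule: free.span_induct)
    case base
    show ?case
    proof (rule free.subspaceI; unfold mem_Collect_eq)
      show "?P 0"
        by (simp add: free_lift_def)
      show "?P (f + g)" if "?P f" "?P g" for f g
        using that free(1)[of f g] keys_add_subset[of f _ g] by simp
      show "?P (Poly_Mapping.map ((*) c) f)" if "?P f" for c f
        using that free(2)[of f c] keys_scale_subset[of f _ c] by simp
    qed
  next
    case (step r)
    note add = linear_mapD(2)[OF bilinear_mapD(1)[OF b]] linear_mapD(2)[OF bilinear_mapD(2)[OF b]]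
      and scale = linear_mapD(3)[OF bilinear_mapD(1)[OF b]] linear_mapD(3)[OF bilinear_mapD(2)[OF b]]
    from step show ?case
      \<comment> \<open>Rewriting a - b - c as a - (b + c) makes every relation a difference of two
        vectors, the form that \<open>diff\<close> expects.\<close>
      unfolding tensor_relations_def diff_diff_eq
      by (elim UnE CollectE exE conjE; hypsubst; intro diff keys_add_subset;
          simp add: free add scale closed keys_add_subset)
  qed
qed

text \<open>The extension vanishes on the kernel, so it is constant on a coset and
  \<open>the_elem\<close> is applied to a genuine singleton.\<close>

lemma tensor_lift_class:
  assumes V: "vspace V" and W: "vspace W" and U: "vspace U" and b: "bilinear_map V W U b"
    and f: "Poly_Mapping.keys f \<subseteq> carrier V \<times> carrier W"
  shows "tensor_lift U b (tensor_class V W f) = free_lift U b f"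
proof -
  interpret U: vspace U by fact
  have "free_lift U b (f + h) = free_lift U b f" if "h \<in> tensor_kernel V W" for h
    using free_lift_tensor_kernel[OF V W U b that] f free_lift_closed[of U V W b f]
      free_lift_add[of U V W b f h] U bilinear_mapD(3)[OF b] by simp
  moreover have "0 \<in> tensor_kernel V W"
    by (simp add: tensor_kernel_eq_span free.span_zero)
  ultimately have "free_lift U b ` tensor_class V W f = {free_lift U b f}"
    by (auto simp: tensor_class_def image_image)
  then show ?thesis
    by (simp add: tensor_lift_def free_lift_def[abs_def])
qed

lemma tensor_lift_pure [simp]:
  assumes "vspace V" "vspace W" "vspace U" "bilinear_map V W U b"
    and "v \<in> carrier V" "w \<in> carrier W"
  shows "tensor_lift U b (pure_tensor V W v w) = b v w"
proof -
  interpret U: vspace U by fact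
  show ?thesis
    using assms free_lift_single[of U V W b v w 1] bilinear_mapD(3)[OF assms(4)]
    by (simp add: pure_tensor_def tensor_lift_class)
qed

lemma linear_tensor_lift:
  assumes V: "vspace V" and W: "vspace W" and U: "vspace U" and b: "bilinear_map V W U b"
  shows "linear_map (tensor_module V W) U (tensor_lift U b)"
proof (rule linear_mapI)
  note closed = bilinear_mapD(3)[OF b]
  note lift = tensor_lift_class[OF V W U b]
  note free = free_lift_add[of U V W b, OF U closed] free_lift_scale[of U V W b, OF U closed]
    free_lift_closed[of U V W b, OF U closed]
  fix x assume x: "x \<in> carrier (tensor_module V W)"
  then show "tensor_lift U b x \<in> carrier U"
    by (elim tensor_carrierE) (simp add: lift free)
  show "tensor_lift U b (c \<odot>\<^bsub>tensor_module V W\<^esub> x) = c \<odot>\<^bsub>U\<^esub> tensor_lift U b x" for c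
    using x by (elim tensor_carrierE) (simp add: lift free keys_add_subset keys_scale_subset)
  fix y assume "y \<in> carrier (tensor_module V W)"
  with x show "tensor_lift U b (x \<oplus>\<^bsub>tensor_module V W\<^esub> y) = tensor_lift U b x \<oplus>\<^bsub>U\<^esub> tensor_lift U b y"
    by (elim tensor_carrierE) (simp add: lift free keys_add_subset keys_scale_subset)
qed

text \<open>For nested lifts, where the inner lift depends on outer variables. For fixed parameters,
  both sides of each law are linear in the tensor \<open>S\<close>, so it is enough to compare them
  on pure tensors, where the law is \<open>lin\<close>.\<close>

lemma bilinear_tensor_lift_param:
  assumes V: "vspace V" and W: "vspace W" and U: "vspace U" and A: "vspace A"
    and b: "\<And>a. a \<in> carrier A \<Longrightarrow> bilinear_map V W U (b a)"
    and lin: "\<And>v w. v \<in> carrier V \<Longrightarrow> w \<in> carrier W \<Longrightarrow> linear_map A U (\<lambda>a. b a v w)"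
  shows "bilinear_map A (tensor_module V W) U (\<lambda>a. tensor_lift U (b a))"
proof (rule bilinear_mapI)
  interpret A: vspace A by fact
  note lift = linear_tensor_lift[OF V W U b]
  show "linear_map (tensor_module V W) U (tensor_lift U (b a))" if "a \<in> carrier A" for a
    using lift that .
  fix S assume S: "S \<in> carrier (tensor_module V W)"
  show "linear_map A U (\<lambda>a. tensor_lift U (b a) S)"
  proof (rule linear_mapI)
    fix a assume a: "a \<in> carrier A"
    show "tensor_lift U (b a) S \<in> carrier U"
      using linear_mapD(1)[OF lift[OF a] S] .
    show "tensor_lift U (b (c \<odot>\<^bsub>A\<^esub> a)) S = c \<odot>\<^bsub>U\<^esub> tensor_lift U (b a) S" for c
      by (rule tensor_linear_map_eqI[OF lift linear_map_scale[OF U lift] V W _ S])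
        (simp_all add: a V W U b linear_mapD(3)[OF lin])
    fix a' assume a': "a' \<in> carrier A"
    show "tensor_lift U (b (a \<oplus>\<^bsub>A\<^esub> a')) S = tensor_lift U (b a) S \<oplus>\<^bsub>U\<^esub> tensor_lift U (b a') S"
      by (rule tensor_linear_map_eqI[OF lift linear_map_add[OF U lift lift] V W _ S])
        (simp_all add: a a' V W U b linear_mapD(2)[OF lin])
  qed
qed

section \<open>Nonassociative algebras and their Lie-centroids\<close>

text \<open>One setting for the Leibniz algebra, the polynomial algebra and their tensor
  product.\<close>

locale nonassoc_algebra = vspace +
  assumes bilinear_mult: "bilinear_map V V V (\<otimes>)"
begin

lemma mult_closed [simp, intro]: "x \<in> carrier V \<Longrightarrow> y \<in> carrier V \<Longrightarrow> x \<otimes> y \<in> carrier V"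
  by (rule bilinear_mapD(3)[OF bilinear_mult])

lemma bilinear_lie_bracket: "bilinear_map V V V (lie_bracket V)"
  unfolding lie_bracket_def[abs_def]
  by (rule bilinear_mapI; rule linear_map_add[OF vspace_axioms])
    (simp_all add: bilinear_mapD[OF bilinear_mult])

lemma lie_bracket_closed [simp, intro]:
  "x \<in> carrier V \<Longrightarrow> y \<in> carrier V \<Longrightarrow> lie_bracket V x y \<in> carrier V"
  by (rule bilinear_mapD(3)[OF bilinear_lie_bracket])

lemma lie_bracket_commute: "x \<in> carrier V \<Longrightarrow> y \<in> carrier V \<Longrightarrow> lie_bracket V x y = lie_bracket V y x"
  by (simp add: lie_bracket_def a_comm)

section \<open>The Lie-centroid and its vector space structure\<close>

lemma lie_centroidD:
  assumes "d \<in> lie_centroid ring_of_type_algebra V"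
  shows "linear_map V V d" and "d \<in> extensional (carrier V)"
    and "x \<in> carrier V \<Longrightarrow> y \<in> carrier V \<Longrightarrow> d (lie_bracket V x y) = lie_bracket V (d x) y"
  using assms by (auto simp: lie_centroid_def linear_endos_def linear_map_def
      ring_of_type_algebra_def PiE_def)

text \<open>The symmetrized bracket is commutative, so compatibility in the left argument gives it
  in the right one. Restriction supplies the extensionality built into
  \<open>linear_endos\<close>.\<close>

lemma restrict_mem_lie_centroid:
  assumes f: "linear_map V V f"
    and lie: "\<And>x y. x \<in> carrier V \<Longrightarrow> y \<in> carrier V \<Longrightarrow>
      f (lie_bracket V x y) = lie_bracket V (f x) y"
  shows "restrict f (carrier V) \<in> lie_centroid ring_of_type_algebra V"
proof -
  have "f (lie_bracket V x y) = lie_bracket V x (f y)" if "x \<in> carrier V" "y \<in> carrier V" for x y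
    using lie[of y x] that linear_mapD(1)[OF f] by (metis lie_bracket_commute)
  then show ?thesis
    using f lie by (simp add: lie_centroid_def linear_endos_def linear_map_def
        ring_of_type_algebra_def)
qed

abbreviation "centroid \<equiv> lie_centroid_module ring_of_type_algebra V"

lemma carrier_centroid: "carrier centroid = lie_centroid ring_of_type_algebra V"
  by (simp add: lie_centroid_module_def)

lemma vspace_centroid: "vspace centroid"
proof (rule vspaceI; (unfold carrier_centroid)?)
  note lie = linear_mapD[OF bilinear_mapD(2)[OF bilinear_lie_bracket]]
  have "linear_map V V (\<lambda>x. \<zero>)"
    by (intro linear_mapI) simp_all
  moreover have "lie_bracket V \<zero> y = \<zero>" if "y \<in> carrier V" for y
    using linear_map_zero[OF vspace_axioms vspace_axioms bilinear_mapD(2)[OF bilinear_lie_bracket that]] .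
  ultimately show "\<zero>\<^bsub>centroid\<^esub> \<in> lie_centroid ring_of_type_algebra V"
    by (simp add: lie_centroid_module_def restrict_mem_lie_centroid)
  fix d assume d: "d \<in> lie_centroid ring_of_type_algebra V"
  note d' = lie_centroidD[OF d] linear_mapD[OF lie_centroidD(1)[OF d]]
  show "c \<odot>\<^bsub>centroid\<^esub> d \<in> lie_centroid ring_of_type_algebra V" for c
    unfolding lie_centroid_module_def module.simps
    by (intro restrict_mem_lie_centroid linear_map_scale vspace_axioms d'(1)) (simp_all add: d' lie)
  \<comment> \<open>The left-hand sides are restricted functions, so off the carrier these equations
    rest on the extensionality of \<open>d\<close>.\<close>
  show "1 \<odot>\<^bsub>centroid\<^esub> d = d" "\<zero>\<^bsub>centroid\<^esub> \<oplus>\<^bsub>centroid\<^esub> d = d"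
    by (auto simp: lie_centroid_module_def d' fun_eq_iff restrict_def extensional_arb[OF d'(2)])
  show "0 \<odot>\<^bsub>centroid\<^esub> d = \<zero>\<^bsub>centroid\<^esub>"
    by (auto simp: lie_centroid_module_def d' fun_eq_iff restrict_def)
  show "a \<odot>\<^bsub>centroid\<^esub> (b \<odot>\<^bsub>centroid\<^esub> d) = (a * b) \<odot>\<^bsub>centroid\<^esub> d"
    "(a + b) \<odot>\<^bsub>centroid\<^esub> d = a \<odot>\<^bsub>centroid\<^esub> d \<oplus>\<^bsub>centroid\<^esub> b \<odot>\<^bsub>centroid\<^esub> d" for a b
    by (auto simp: lie_centroid_module_def d' fun_eq_iff restrict_def scale_scale scale_add_left)
  fix e assume e: "e \<in> lie_centroid ring_of_type_algebra V"
  note e' = lie_centroidD[OF e] linear_mapD[OF lie_centroidD(1)[OF e]]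
  show "d \<oplus>\<^bsub>centroid\<^esub> e \<in> lie_centroid ring_of_type_algebra V"
    unfolding lie_centroid_module_def ring.simps
    by (intro restrict_mem_lie_centroid linear_map_add vspace_axioms d'(1) e'(1))
      (simp_all add: d' e' lie)
  show "d \<oplus>\<^bsub>centroid\<^esub> e = e \<oplus>\<^bsub>centroid\<^esub> d"
    by (auto simp: lie_centroid_module_def d' e' fun_eq_iff restrict_def a_comm)
  show "a \<odot>\<^bsub>centroid\<^esub> (d \<oplus>\<^bsub>centroid\<^esub> e) = a \<odot>\<^bsub>centroid\<^esub> d \<oplus>\<^bsub>centroid\<^esub> a \<odot>\<^bsub>centroid\<^esub> e" for a
    by (auto simp: lie_centroid_module_def d' e' fun_eq_iff restrict_def scale_add_right)
  fix g assume g: "g \<in> lie_centroid ring_of_type_algebra V"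
  note g' = lie_centroidD[OF g] linear_mapD[OF lie_centroidD(1)[OF g]]
  show "d \<oplus>\<^bsub>centroid\<^esub> e \<oplus>\<^bsub>centroid\<^esub> g = d \<oplus>\<^bsub>centroid\<^esub> (e \<oplus>\<^bsub>centroid\<^esub> g)"
    by (auto simp: lie_centroid_module_def d' e' g' fun_eq_iff restrict_def a_assoc)
qed

text \<open>Evaluation of centroid maps; it will make \<open>tensor_endo\<close> linear in the
  factor from the centroid.\<close>

lemma bilinear_centroid_apply: "bilinear_map centroid V V (\<lambda>d. d)"
  by (intro bilinear_mapI) (simp_all add: carrier_centroid lie_centroidD(1),
      auto intro!: linear_mapI simp: carrier_centroid linear_mapD[OF lie_centroidD(1)],
      simp_all add: lie_centroid_module_def)

end

lemma leibniz_nonassoc_algebra: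
  fixes G :: "('k::field, 'g, 'n) module_scheme"
  assumes "leibniz_algebra ring_of_type_algebra G"
  shows "nonassoc_algebra G"
proof -
  interpret leibniz_algebra ring_of_type_algebra G by fact
  have [simp]: "c \<in> carrier ring_of_type_algebra" for c :: 'k
    by (simp add: ring_of_type_algebra_def)
  show ?thesis
    by unfold_locales (intro bilinear_mapI linear_mapI; simp add: bracket_closed bracket_add_left
        bracket_add_right bracket_smult_left bracket_smult_right)
qed

text \<open>If all symmetrized brackets vanished, the zero ideal would be one of the ideals
  intersected in \<open>gamma2_Lie\<close>.\<close>

lemma gamma2_nontrivial:
  fixes G :: "('k::field, 'g, 'n) module_scheme"
  assumes "leibniz_algebra ring_of_type_algebra G" and "gamma2_Lie ring_of_type_algebra G \<noteq> {\<zero>\<^bsub>G\<^esub>}"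
  obtains x y where "x \<in> carrier G" "y \<in> carrier G" "lie_bracket G x y \<noteq> \<zero>\<^bsub>G\<^esub>"
proof -
  interpret nonassoc_algebra G
    using assms(1) by (rule leibniz_nonassoc_algebra)
  have "\<exists>x\<in>carrier G. \<exists>y\<in>carrier G. lie_bracket G x y \<noteq> \<zero>\<^bsub>G\<^esub>"
  proof (rule ccontr)
    assume *: "\<not> ?thesis"
    have "submodule {\<zero>\<^bsub>G\<^esub>} ring_of_type_algebra G"
      by (rule submoduleI) auto
    moreover have "x \<otimes>\<^bsub>G\<^esub> \<zero>\<^bsub>G\<^esub> = \<zero>\<^bsub>G\<^esub>" "\<zero>\<^bsub>G\<^esub> \<otimes>\<^bsub>G\<^esub> x = \<zero>\<^bsub>G\<^esub>" if "x \<in> carrier G" for x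
      using linear_map_zero[OF vspace_axioms vspace_axioms bilinear_mapD(1)[OF bilinear_mult that]]
        linear_map_zero[OF vspace_axioms vspace_axioms bilinear_mapD(2)[OF bilinear_mult that]] .
    ultimately have "leibniz_ideal ring_of_type_algebra G {\<zero>\<^bsub>G\<^esub>}"
      by (simp add: leibniz_ideal_def)
    then have "gamma2_Lie ring_of_type_algebra G \<subseteq> {\<zero>\<^bsub>G\<^esub>}"
      using * by (auto simp: gamma2_Lie_def)
    \<comment> \<open>The hypothesis excludes only the set consisting of zero, so the empty set has
      to be ruled out as well.\<close>
    moreover have "\<zero>\<^bsub>G\<^esub> \<in> gamma2_Lie ring_of_type_algebra G"
      by (auto simp: gamma2_Lie_def leibniz_ideal_def submodule_def dest: subgroup.one_closed)
    ultimately show False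
      using assms(2) by blast
  qed
  then show thesis
    using that by blast
qed

section \<open>Tensor products of algebras\<close>

lemma tensor_algebra_simps [simp]:
  "carrier (tensor_algebra A G) = carrier (tensor_module A G)"
  "add (tensor_algebra A G) = add (tensor_module A G)"
  "module.smult (tensor_algebra A G) = module.smult (tensor_module A G)"
  "\<zero>\<^bsub>tensor_algebra A G\<^esub> = \<zero>\<^bsub>tensor_module A G\<^esub>"
  by (simp_all add: tensor_algebra_def)

text \<open>Linearity does not involve the product, the only field in which the two records
  differ.\<close>

lemma linear_map_tensor_algebra [simp]:
  "linear_map (tensor_algebra A G) = linear_map (tensor_module A G)"
  "linear_map U (tensor_algebra A G) = linear_map U (tensor_module A G)"
  by (simp_all add: linear_map_def fun_eq_iff)

lemma vspace_tensor_algebra: "vspace (tensor_algebra A G)"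
proof -
  interpret vspace "tensor_module A G" by (rule vspace_tensor_module)
  show ?thesis
    by (rule vspaceI) (simp_all add: a_ac scale_add_left scale_add_right scale_scale)
qed

locale algebra_pair = A: nonassoc_algebra A + G: nonassoc_algebra G
  for A :: "('k::field, 'a, 'm) module_scheme" and G :: "('k, 'g, 'n) module_scheme"
begin

abbreviation "T \<equiv> tensor_module A G"

text \<open>Used with two choices of \<open>f\<close>: multiplication by a fixed element of
  \<open>G\<close> for the product of tensors, and a centroid map for
  \<open>tensor_endo\<close>.\<close>

lemma bilinear_pure_mult:
  assumes "a \<in> carrier A" "linear_map G G f"
  shows "bilinear_map A G T (\<lambda>p g. pure_tensor A G (a \<otimes>\<^bsub>A\<^esub> p) (f g))"
proof (rule bilinear_mapI)
  show "linear_map G T (\<lambda>g. pure_tensor A G (a \<otimes>\<^bsub>A\<^esub> p) (f g))" if "p \<in> carrier A" for p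
    using assms that by (intro linear_map_comp[OF assms(2) linear_pure_tensor_right]) simp
  show "linear_map A T (\<lambda>p. pure_tensor A G (a \<otimes>\<^bsub>A\<^esub> p) (f g))" if "g \<in> carrier G" for g
    using assms that linear_mapD(1)
    by (intro linear_map_comp[OF bilinear_mapD(1)[OF A.bilinear_mult] linear_pure_tensor_left])
qed

text \<open>The inner lift in the product of tensors is bilinear in the components of the left
  factor, which is what the outer lift requires.\<close>

lemma bilinear_tensor_mult_aux:
  assumes "S \<in> carrier T"
  shows "bilinear_map A G T (\<lambda>a g. tensor_lift T (\<lambda>p h. pure_tensor A G (a \<otimes>\<^bsub>A\<^esub> p) (g \<otimes>\<^bsub>G\<^esub> h)) S)"
proof -
  note param = bilinear_mapD(2)[OF bilinear_tensor_lift_param[OF A.vspace_axioms G.vspace_axioms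
      vspace_tensor_module] assms]
  note b = bilinear_pure_mult[OF _ bilinear_mapD(1)[OF G.bilinear_mult]]
  show ?thesis
  proof (rule bilinear_mapI)
    show "linear_map G T (\<lambda>g. tensor_lift T (\<lambda>p h. pure_tensor A G (a \<otimes>\<^bsub>A\<^esub> p) (g \<otimes>\<^bsub>G\<^esub> h)) S)"
      if a: "a \<in> carrier A" for a
      by (rule param[OF G.vspace_axioms b[OF a]])
        (simp_all add: a linear_map_comp[OF bilinear_mapD(2)[OF G.bilinear_mult] linear_pure_tensor_right])
    show "linear_map A T (\<lambda>a. tensor_lift T (\<lambda>p h. pure_tensor A G (a \<otimes>\<^bsub>A\<^esub> p) (g \<otimes>\<^bsub>G\<^esub> h)) S)"
      if g: "g \<in> carrier G" for g
      by (rule param[OF A.vspace_axioms b[OF _ g]])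
        (simp_all add: g linear_map_comp[OF bilinear_mapD(2)[OF A.bilinear_mult] linear_pure_tensor_left])
  qed
qed

lemma nonassoc_tensor_algebra: "nonassoc_algebra (tensor_algebra A G)"
proof -
  interpret vspace "tensor_algebra A G" by (rule vspace_tensor_algebra)
  \<comment> \<open>The outer lift runs over the left factor, so the right factor plays the
    parameter and comes first. Bilinearity is symmetric in the two arguments, and the order is
    restored afterwards.\<close>
  have "bilinear_map T T T (\<lambda>S' S. S \<otimes>\<^bsub>tensor_algebra A G\<^esub> S')"
    by (simp add: tensor_algebra_def, rule bilinear_tensor_lift_param[OF A.vspace_axioms
          G.vspace_axioms vspace_tensor_module vspace_tensor_module bilinear_tensor_mult_aux])
      (simp_all add: linear_tensor_lift A.vspace_axioms G.vspace_axioms vspace_tensor_module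
        bilinear_pure_mult bilinear_mapD(1)[OF G.bilinear_mult])
  then show ?thesis
    by unfold_locales (simp add: bilinear_map_def)
qed

lemma tensor_mult_pure:
  assumes "a \<in> carrier A" "g \<in> carrier G" "b \<in> carrier A" "h \<in> carrier G"
  shows "pure_tensor A G a g \<otimes>\<^bsub>tensor_algebra A G\<^esub> pure_tensor A G b h =
    pure_tensor A G (a \<otimes>\<^bsub>A\<^esub> b) (g \<otimes>\<^bsub>G\<^esub> h)"
  using assms bilinear_tensor_mult_aux bilinear_pure_mult bilinear_mapD(1)[OF G.bilinear_mult]
  by (simp add: tensor_algebra_def A.vspace_axioms G.vspace_axioms vspace_tensor_module)

end

context algebra_pair
begin

text \<open>By commutativity the two products share the left factor ab, and their sum is collected
  in the right factor.\<close>

lemma lie_bracket_pure: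
  assumes comm: "\<And>a b. a \<in> carrier A \<Longrightarrow> b \<in> carrier A \<Longrightarrow> a \<otimes>\<^bsub>A\<^esub> b = b \<otimes>\<^bsub>A\<^esub> a"
    and "a \<in> carrier A" "g \<in> carrier G" "b \<in> carrier A" "h \<in> carrier G"
  shows "lie_bracket (tensor_algebra A G) (pure_tensor A G a g) (pure_tensor A G b h) =
    pure_tensor A G (a \<otimes>\<^bsub>A\<^esub> b) (lie_bracket G g h)"
  using assms linear_mapD(2)[OF linear_pure_tensor_right, of "a \<otimes>\<^bsub>A\<^esub> b" A "g \<otimes>\<^bsub>G\<^esub> h" G "h \<otimes>\<^bsub>G\<^esub> g"]
  by (simp add: lie_bracket_def tensor_mult_pure comm[of b a])

text \<open>Evaluates the outer lift of \<open>tensor_endo\<close>; this is legitimate because the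
  inner lift is bilinear in \<open>a\<close> and \<open>d\<close>.\<close>

lemma tensor_endo_pure:
  assumes a: "a \<in> carrier A" and d: "d \<in> lie_centroid ring_of_type_algebra G"
  shows "tensor_endo A G (pure_tensor A G.centroid a d) =
    (\<lambda>S\<in>carrier T. tensor_lift T (\<lambda>p g. pure_tensor A G (a \<otimes>\<^bsub>A\<^esub> p) (d g)) S)"
proof -
  have "tensor_lift T (\<lambda>a d. tensor_lift T (\<lambda>p g. pure_tensor A G (a \<otimes>\<^bsub>A\<^esub> p) (d g)) S)
      (pure_tensor A G.centroid a d) = tensor_lift T (\<lambda>p g. pure_tensor A G (a \<otimes>\<^bsub>A\<^esub> p) (d g)) S"
    if S: "S \<in> carrier T" for S
  proof (rule tensor_lift_pure[OF A.vspace_axioms G.vspace_centroid vspace_tensor_module _ a])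
    note param = bilinear_mapD(2)[OF bilinear_tensor_lift_param[OF A.vspace_axioms G.vspace_axioms
        vspace_tensor_module] S]
    note b = bilinear_pure_mult[OF _ G.lie_centroidD(1)]
    show "bilinear_map A G.centroid T (\<lambda>a d. tensor_lift T (\<lambda>p g. pure_tensor A G (a \<otimes>\<^bsub>A\<^esub> p) (d g)) S)"
    proof (rule bilinear_mapI; (unfold G.carrier_centroid)?)
      show "linear_map G.centroid T (\<lambda>d. tensor_lift T (\<lambda>p g. pure_tensor A G (a \<otimes>\<^bsub>A\<^esub> p) (d g)) S)"
        if a: "a \<in> carrier A" for a
        by (rule param[OF G.vspace_centroid b[OF a]])
          (simp_all add: a G.carrier_centroid
            linear_map_comp[OF bilinear_mapD(2)[OF G.bilinear_centroid_apply] linear_pure_tensor_right])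
      show "linear_map A T (\<lambda>a. tensor_lift T (\<lambda>p g. pure_tensor A G (a \<otimes>\<^bsub>A\<^esub> p) (d g)) S)"
        if d: "d \<in> lie_centroid ring_of_type_algebra G" for d
        by (rule param[OF A.vspace_axioms b[OF _ d]])
          (simp_all add: linear_mapD(1)[OF G.lie_centroidD(1)[OF d]]
            linear_map_comp[OF bilinear_mapD(2)[OF A.bilinear_mult] linear_pure_tensor_left])
    qed
  qed (simp add: d G.carrier_centroid)
  then show ?thesis
    unfolding tensor_endo_def by (rule restrict_ext)
qed

lemma bilinear_tensor_eqI:
  assumes f: "bilinear_map T T U f" and g: "bilinear_map T T U g"
    and pure: "\<And>a x b y. a \<in> carrier A \<Longrightarrow> x \<in> carrier G \<Longrightarrow> b \<in> carrier A \<Longrightarrow> y \<in> carrier G \<Longrightarrow>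
      f (pure_tensor A G a x) (pure_tensor A G b y) = g (pure_tensor A G a x) (pure_tensor A G b y)"
    and S: "S \<in> carrier T" and S': "S' \<in> carrier T"
  shows "f S S' = g S S'"
proof (rule tensor_linear_map_eqI[OF bilinear_mapD(2)[OF f S'] bilinear_mapD(2)[OF g S']
      A.vspace_axioms G.vspace_axioms _ S])
  fix a x assume a: "a \<in> carrier A" "x \<in> carrier G"
  show "f (pure_tensor A G a x) S' = g (pure_tensor A G a x) S'"
    by (rule tensor_linear_map_eqI[OF bilinear_mapD(1)[OF f] bilinear_mapD(1)[OF g]
          A.vspace_axioms G.vspace_axioms _ S']) (use a pure in auto)
qed

end

section \<open>Polynomials with coefficients in a Leibniz algebra\<close>

lemma polynomial_algebra_simps [simp]:
  "carrier polynomial_algebra = UNIV"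
  "p \<otimes>\<^bsub>polynomial_algebra\<^esub> q = p * q"
  "p \<oplus>\<^bsub>polynomial_algebra\<^esub> q = p + q"
  "\<zero>\<^bsub>polynomial_algebra\<^esub> = 0"
  "\<one>\<^bsub>polynomial_algebra\<^esub> = 1"
  "c \<odot>\<^bsub>polynomial_algebra\<^esub> p = Poly_Mapping.map ((*) c) p"
  by (simp_all add: polynomial_algebra_def)

lemma nonassoc_polynomial_algebra: "nonassoc_algebra polynomial_algebra"
proof (intro nonassoc_algebra.intro nonassoc_algebra_axioms.intro)
  show "vspace polynomial_algebra"
    by (rule vspaceI) (simp_all add: ac_simps free.scale_left_distrib free.scale_right_distrib)
  show "bilinear_map polynomial_algebra polynomial_algebra polynomial_algebra
      (\<otimes>\<^bsub>polynomial_algebra\<^esub>)"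
    by (intro bilinear_mapI linear_mapI) (simp_all add: algebra_simps mult_map_scale_conv_mult)
qed

text \<open>The parameter \<open>vars\<close> carries no data; it fixes the index type of the
  variables, which \<open>G\<close> does not determine.\<close>

locale polynomial_tensor = G: nonassoc_algebra G
  for G :: "('k::field, 'g, 'n) module_scheme" +
  fixes vars :: "'x::finite itself"
begin

abbreviation R :: "('k, ('x \<Rightarrow>\<^sub>0 nat) \<Rightarrow>\<^sub>0 'k) module"
  where "R \<equiv> polynomial_algebra"

sublocale algebra_pair R G
  by (intro algebra_pair.intro nonassoc_polynomial_algebra G.nonassoc_algebra_axioms)

abbreviation "RG \<equiv> tensor_algebra R G"

sublocale RG: nonassoc_algebra RG
  by (rule nonassoc_tensor_algebra)

sublocale T: vspace T
  by (rule vspace_tensor_module)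

section \<open>Tensors as polynomials with coefficients in \<open>G\<close>\<close>

definition coef :: "('x \<Rightarrow>\<^sub>0 nat) \<Rightarrow> (((('x \<Rightarrow>\<^sub>0 nat) \<Rightarrow>\<^sub>0 'k) \<times> 'g) \<Rightarrow>\<^sub>0 'k) set \<Rightarrow> 'g"
  where "coef m = tensor_lift G (\<lambda>p x. Poly_Mapping.lookup p m \<odot>\<^bsub>G\<^esub> x)"

lemma bilinear_coef: "bilinear_map R G G (\<lambda>p x. Poly_Mapping.lookup p m \<odot>\<^bsub>G\<^esub> x)"
  by (intro bilinear_mapI linear_mapI)
    (simp_all add: G.scale_add_right G.scale_add_left G.scale_scale lookup_add mult.commute)

lemma linear_coef: "linear_map T G (coef m)"
  unfolding coef_def
  by (rule linear_tensor_lift[OF A.vspace_axioms G.vspace_axioms G.vspace_axioms bilinear_coef])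

lemmas coef_closed = linear_mapD(1)[OF linear_coef]
  and coef_add = linear_mapD(2)[OF linear_coef]
  and coef_zero = linear_map_zero[OF T.vspace_axioms G.vspace_axioms linear_coef]

lemma coef_pure: "x \<in> carrier G \<Longrightarrow> coef m (pure_tensor R G p x) = Poly_Mapping.lookup p m \<odot>\<^bsub>G\<^esub> x"
  unfolding coef_def
  using tensor_lift_pure[OF A.vspace_axioms G.vspace_axioms G.vspace_axioms bilinear_coef] by simp

lemma finite_coef_support:
  assumes "S \<in> carrier T"
  shows "finite {m. coef m S \<noteq> \<zero>\<^bsub>G\<^esub>}"
  using assms A.vspace_axioms G.vspace_axioms
proof (induction S rule: tensor_induct)
  case (pure p x)
  then have "{m. coef m (pure_tensor R G p x) \<noteq> \<zero>\<^bsub>G\<^esub>} \<subseteq> Poly_Mapping.keys p"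
    by (auto simp: coef_pure in_keys_iff)
  then show ?case
    by (rule finite_subset) simp
next
  case (add S S')
  have "{m. coef m (S \<oplus>\<^bsub>T\<^esub> S') \<noteq> \<zero>\<^bsub>G\<^esub>} \<subseteq> {m. coef m S \<noteq> \<zero>\<^bsub>G\<^esub>} \<union> {m. coef m S' \<noteq> \<zero>\<^bsub>G\<^esub>}"
    using add by (auto simp: coef_add)
  then show ?case
    by (rule finite_subset) (use add in simp)
qed

text \<open>A polynomial is a sum of monomials with scalar coefficients, and each scalar moves into
  the factor from \<open>G\<close>.\<close>

lemma monomial_induct [consumes 1, case_names zero monomial add]:
  assumes S: "S \<in> carrier T"
    and zero: "P \<zero>\<^bsub>T\<^esub>"
    and monomial: "\<And>m x. x \<in> carrier G \<Longrightarrow> P (pure_tensor R G (Poly_Mapping.single m 1) x)"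
    and add: "\<And>S S'. S \<in> carrier T \<Longrightarrow> S' \<in> carrier T \<Longrightarrow> P S \<Longrightarrow> P S' \<Longrightarrow> P (S \<oplus>\<^bsub>T\<^esub> S')"
  shows "P S"
  using S A.vspace_axioms G.vspace_axioms
proof (induction S rule: tensor_induct)
  case (pure p x)
  note left = linear_pure_tensor_left[OF pure(2), where V = R]
  have "Poly_Mapping.keys p \<subseteq> UNIV"
    by simp
  then show ?case
  proof (induction p rule: single_plus_induct)
    case zero
    show ?case
      using linear_map_zero[OF A.vspace_axioms T.vspace_axioms left] assms(2) by simp
  next
    case (single_plus m c p)
    have "pure_tensor R G (Poly_Mapping.single m c) x =
        pure_tensor R G (Poly_Mapping.single m 1) (c \<odot>\<^bsub>G\<^esub> x)"
      using linear_mapD(3)[OF left, of "Poly_Mapping.single m 1" c] pure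
        linear_mapD(3)[OF linear_pure_tensor_right, of "Poly_Mapping.single m 1" R x G c]
      by simp
    then show ?case
      using linear_mapD(2)[OF left, of "Poly_Mapping.single m c" p] pure single_plus
      by (simp add: assms)
  qed
qed (rule add)

definition coef_sum where
  "coef_sum N S = (\<Oplus>\<^bsub>T\<^esub>m\<in>N. pure_tensor R G (Poly_Mapping.single m 1) (coef m S))"

text \<open>A tensor is recovered from its coefficients. The claim covers all sufficiently large
  finite \<open>N\<close>, so that different tensors can be expanded over one common set.\<close>

lemma tensor_eq_coef_sum:
  assumes "S \<in> carrier T"
  shows "\<exists>M. finite M \<and> (\<forall>N. finite N \<longrightarrow> M \<subseteq> N \<longrightarrow> coef_sum N S = S)"
proof -
  have right: "linear_map G T (pure_tensor R G p)" for p
    by (rule linear_pure_tensor_right) simp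
  note pure_zero = linear_map_zero[OF G.vspace_axioms T.vspace_axioms right]
  from assms show ?thesis
  proof (induction S rule: monomial_induct)
    case zero
    show ?case
      by (rule exI[of _ "{}"]) (simp add: coef_sum_def coef_zero pure_zero)
  next
    case (monomial m x)
    have "coef_sum N (pure_tensor R G (Poly_Mapping.single m 1) x)
        = pure_tensor R G (Poly_Mapping.single m 1) x" if N: "finite N" "m \<in> N" for N
    proof -
      \<comment> \<open>Only the coefficient at \<open>m\<close> is nonzero, so at most one summand
        survives.\<close>
      have "coef_sum N (pure_tensor R G (Poly_Mapping.single m 1) x)
        = (\<Oplus>\<^bsub>T\<^esub>n\<in>N. if m = n then pure_tensor R G (Poly_Mapping.single n 1) x else \<zero>\<^bsub>T\<^esub>)"
        unfolding coef_sum_def using monomial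
        by (intro T.finsum_cong') (simp_all add: coef_pure lookup_single pure_zero)
      also have "\<dots> = pure_tensor R G (Poly_Mapping.single m 1) x"
        using T.finsum_singleton[OF N(2,1), of "\<lambda>n. pure_tensor R G (Poly_Mapping.single n 1) x"]
          monomial by simp
      finally show ?thesis .
    qed
    then show ?case
      by (intro exI[of _ "{m}"] conjI allI impI) auto
  next
    case (add S S')
    obtain M where M: "finite M" "\<forall>N. finite N \<longrightarrow> M \<subseteq> N \<longrightarrow> coef_sum N S = S"
      using add.IH(1) by (elim exE conjE)
    obtain M' where M': "finite M'" "\<forall>N. finite N \<longrightarrow> M' \<subseteq> N \<longrightarrow> coef_sum N S' = S'"
      using add.IH(2) by (elim exE conjE)
    have "coef_sum N (S \<oplus>\<^bsub>T\<^esub> S') = coef_sum N S \<oplus>\<^bsub>T\<^esub> coef_sum N S'" for N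
    proof -
      have "coef_sum N (S \<oplus>\<^bsub>T\<^esub> S')
          = (\<Oplus>\<^bsub>T\<^esub>m\<in>N. pure_tensor R G (Poly_Mapping.single m 1) (coef m S) \<oplus>\<^bsub>T\<^esub>
            pure_tensor R G (Poly_Mapping.single m 1) (coef m S'))"
        unfolding coef_sum_def using add.hyps
        by (intro T.finsum_cong')
          (simp_all add: coef_add coef_closed linear_mapD(2)[OF right] Pi_def)
      also have "\<dots> = coef_sum N S \<oplus>\<^bsub>T\<^esub> coef_sum N S'"
        unfolding coef_sum_def using add.hyps
        by (intro T.finsum_addf) (simp_all add: coef_closed Pi_def)
      finally show ?thesis .
    qed
    then have "\<forall>N. finite N \<longrightarrow> M \<union> M' \<subseteq> N \<longrightarrow> coef_sum N (S \<oplus>\<^bsub>T\<^esub> S') = S \<oplus>\<^bsub>T\<^esub> S'"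
      using M(2) M'(2) by simp
    then show ?case
      using M(1) M'(1) by (intro exI[of _ "M \<union> M'"] conjI) simp_all
  qed
qed

text \<open>Both tensors are expanded over the union of their index sets, where the expansions agree
  term by term.\<close>

lemma tensor_eqI:
  assumes S: "S \<in> carrier T" "S' \<in> carrier T" and coef: "\<And>m. coef m S = coef m S'"
  shows "S = S'"
proof -
  obtain M where M: "finite M" "\<forall>N. finite N \<longrightarrow> M \<subseteq> N \<longrightarrow> coef_sum N S = S"
    using tensor_eq_coef_sum[OF S(1)] by (elim exE conjE)
  obtain M' where M': "finite M'" "\<forall>N. finite N \<longrightarrow> M' \<subseteq> N \<longrightarrow> coef_sum N S' = S'"
    using tensor_eq_coef_sum[OF S(2)] by (elim exE conjE)
  have "coef_sum (M \<union> M') S = S" "coef_sum (M \<union> M') S' = S'"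
    using M M' by simp_all
  then show ?thesis
    by (simp add: coef_sum_def coef)
qed

lemma pure_tensor_cancel:
  assumes x: "x \<in> carrier G" "x \<noteq> \<zero>\<^bsub>G\<^esub>" and eq: "pure_tensor R G p x = pure_tensor R G q x"
  shows "p = q"
proof (rule poly_mapping_eqI)
  fix m
  have "Poly_Mapping.lookup p m \<odot>\<^bsub>G\<^esub> x = Poly_Mapping.lookup q m \<odot>\<^bsub>G\<^esub> x"
    using arg_cong[OF eq, of "coef m"] x by (simp add: coef_pure)
  then show "Poly_Mapping.lookup p m = Poly_Mapping.lookup q m"
    by (rule G.scale_cancel[OF x])
qed

lemma lie_bracket_pure_poly:
  "x \<in> carrier G \<Longrightarrow> y \<in> carrier G \<Longrightarrow>
    lie_bracket RG (pure_tensor R G p x) (pure_tensor R G q y) = pure_tensor R G (p * q) (lie_bracket G x y)"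
  using lie_bracket_pure[of p x q y] by (simp add: mult.commute)

section \<open>Multiplication by a polynomial, the endomorphism of r \<otimes> Id\<close>

definition poly_mult ::
  "(('x \<Rightarrow>\<^sub>0 nat) \<Rightarrow>\<^sub>0 'k) \<Rightarrow> (((('x \<Rightarrow>\<^sub>0 nat) \<Rightarrow>\<^sub>0 'k) \<times> 'g) \<Rightarrow>\<^sub>0 'k) set \<Rightarrow>
    (((('x \<Rightarrow>\<^sub>0 nat) \<Rightarrow>\<^sub>0 'k) \<times> 'g) \<Rightarrow>\<^sub>0 'k) set"
  where "poly_mult r = tensor_lift T (\<lambda>p x. pure_tensor R G (r * p) x)"

lemma bilinear_poly_mult: "bilinear_map R G T (\<lambda>p x. pure_tensor R G (r * p) x)"
  using bilinear_pure_mult[of r "\<lambda>x. x"] by (simp add: linear_map_def)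

lemma linear_poly_mult: "linear_map T T (poly_mult r)"
  unfolding poly_mult_def
  by (rule linear_tensor_lift[OF A.vspace_axioms G.vspace_axioms T.vspace_axioms bilinear_poly_mult])

lemma poly_mult_pure: "x \<in> carrier G \<Longrightarrow> poly_mult r (pure_tensor R G p x) = pure_tensor R G (r * p) x"
  unfolding poly_mult_def
  using tensor_lift_pure[OF A.vspace_axioms G.vspace_axioms T.vspace_axioms bilinear_poly_mult] by simp

text \<open>Both sides of the centroid equation are bilinear; on pure tensors it is the
  associativity r(pq) = (rp)q.\<close>

lemma poly_mult_mem_lie_centroid:
  "restrict (poly_mult r) (carrier T) \<in> lie_centroid ring_of_type_algebra RG"
proof -
  have lie: "bilinear_map T T T (lie_bracket RG)"
    using RG.bilinear_lie_bracket by (simp add: bilinear_map_def)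
  have "poly_mult r (lie_bracket RG S S') = lie_bracket RG (poly_mult r S) S'"
    if "S \<in> carrier T" "S' \<in> carrier T" for S S'
  proof (rule bilinear_tensor_eqI[OF _ _ _ that])
    show "bilinear_map T T T (\<lambda>S S'. poly_mult r (lie_bracket RG S S'))"
      by (rule bilinear_mapI; rule linear_map_comp[OF _ linear_poly_mult])
        (simp_all add: bilinear_mapD[OF lie])
    show "bilinear_map T T T (\<lambda>S S'. lie_bracket RG (poly_mult r S) S')"
      using bilinear_mapD(1)[OF lie linear_mapD(1)[OF linear_poly_mult]]
        linear_map_comp[OF linear_poly_mult bilinear_mapD(2)[OF lie]]
      by (rule bilinear_mapI)
  qed (simp add: lie_bracket_pure_poly poly_mult_pure mult.assoc)
  then show ?thesis
    using RG.restrict_mem_lie_centroid[of "poly_mult r"] linear_poly_mult by simp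
qed

end

section \<open>Scalar Lie-centroid: both sides of the theorem are parametrized by
  \<open>R\<close>\<close>

locale central_polynomial_tensor = polynomial_tensor +
  assumes central: "lie_centroid ring_of_type_algebra G = {\<lambda>x\<in>carrier G. c \<odot>\<^bsub>G\<^esub> x | c. True}"
begin

abbreviation "scalar \<equiv> \<lambda>c. \<lambda>x\<in>carrier G. c \<odot>\<^bsub>G\<^esub> x"

lemma id_mem_centroid: "scalar 1 \<in> carrier G.centroid"
  using central by (auto simp: G.carrier_centroid)

text \<open>Since r \<otimes> c Id = cr \<otimes> Id, and since tensors with the same right factor
  add in the left one, every tensor here is pure.\<close>

lemma carrier_tensor_centroid:
  "carrier (tensor_module R G.centroid) = range (\<lambda>r. pure_tensor R G.centroid r (scalar 1))"
proof (intro equalityI subsetI)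
  fix Z assume "Z \<in> carrier (tensor_module R G.centroid)"
  then show "Z \<in> range (\<lambda>r. pure_tensor R G.centroid r (scalar 1))"
    using A.vspace_axioms G.vspace_centroid
  proof (induction Z rule: tensor_induct)
    case (pure r d)
    then obtain c where "d = scalar c"
      by (auto simp: G.carrier_centroid central)
    then have "d = c \<odot>\<^bsub>G.centroid\<^esub> scalar 1"
      by (auto simp: lie_centroid_module_def restrict_def)
    then have "pure_tensor R G.centroid r d = pure_tensor R G.centroid (c \<odot>\<^bsub>R\<^esub> r) (scalar 1)"
      using linear_mapD(3)[OF linear_pure_tensor_right[of r R G.centroid] id_mem_centroid, of c]
        linear_mapD(3)[OF linear_pure_tensor_left[OF id_mem_centroid, of R], of r c]
      by simp
    then show ?case
      by (rule range_eqI)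
  next
    case (add S S')
    from add.IH obtain r s where "S = pure_tensor R G.centroid r (scalar 1)"
      "S' = pure_tensor R G.centroid s (scalar 1)"
      by (elim rangeE)
    then have "S \<oplus>\<^bsub>tensor_module R G.centroid\<^esub> S' = pure_tensor R G.centroid (r + s) (scalar 1)"
      using linear_mapD(2)[OF linear_pure_tensor_left[OF id_mem_centroid, of R], of r s] by simp
    then show ?case
      by (rule range_eqI)
  qed
next
  fix Z assume "Z \<in> range (\<lambda>r. pure_tensor R G.centroid r (scalar 1))"
  then show "Z \<in> carrier (tensor_module R G.centroid)"
    using pure_tensor_closed[OF _ id_mem_centroid, of _ R] by auto
qed

text \<open>As \<open>scalar 1\<close> is the identity only on the carrier of \<open>G\<close>, the
  two lifts are compared on pure tensors rather than as terms.\<close>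

lemma tensor_endo_scalar:
  "tensor_endo R G (pure_tensor R G.centroid r (scalar 1)) = restrict (poly_mult r) (carrier T)"
proof -
  note id = id_mem_centroid[unfolded G.carrier_centroid]
  have r: "r \<in> carrier R"
    by simp
  note b = bilinear_pure_mult[OF r G.lie_centroidD(1)[OF id]]
  note vs = A.vspace_axioms G.vspace_axioms T.vspace_axioms
  have pure: "tensor_lift T (\<lambda>p g. pure_tensor R G (r \<otimes>\<^bsub>R\<^esub> p) (scalar 1 g)) (pure_tensor R G p x)
      = poly_mult r (pure_tensor R G p x)" if "p \<in> carrier R" "x \<in> carrier G" for p x
    unfolding tensor_lift_pure[OF vs b that] using that by (simp add: poly_mult_pure)
  show ?thesis
    unfolding tensor_endo_pure[OF r id]
    by (rule restrict_ext)
      (rule tensor_linear_map_eqI[OF linear_tensor_lift[OF vs b] linear_poly_mult vs(1,2) pure])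
qed

lemma lie_centroid_tensor_eq_poly_mult:
  assumes d: "d \<in> lie_centroid ring_of_type_algebra RG"
    and xy: "x\<^sub>0 \<in> carrier G" "y\<^sub>0 \<in> carrier G" "lie_bracket G x\<^sub>0 y\<^sub>0 \<noteq> \<zero>\<^bsub>G\<^esub>"
  obtains r where "d = restrict (poly_mult r) (carrier T)"
proof -
  have lin: "linear_map T T d"
    using RG.lie_centroidD(1)[OF d] by simp
  note d_closed = linear_mapD(1)[OF lin]
  have d_lie: "d (lie_bracket RG S S') = lie_bracket RG (d S) S'"
    if "S \<in> carrier T" "S' \<in> carrier T" for S S'
    using RG.lie_centroidD(3)[OF d] that by simp
  have lie: "bilinear_map T T T (lie_bracket RG)"
    using RG.bilinear_lie_bracket by (simp add: bilinear_map_def)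
  \<comment> \<open>Bracketing with the constant polynomial y acts on each coefficient separately;
    this brings the centroid equation down to \<open>G\<close>.\<close>
  have coef_lie: "coef m (lie_bracket RG S (pure_tensor R G 1 y)) = lie_bracket G (coef m S) y"
    if S: "S \<in> carrier T" and y: "y \<in> carrier G" for S m y
  proof (rule tensor_linear_map_eqI[OF _ _ A.vspace_axioms G.vspace_axioms _ S])
    show "linear_map T G (\<lambda>S. coef m (lie_bracket RG S (pure_tensor R G 1 y)))"
      using y by (intro linear_map_comp[OF bilinear_mapD(2)[OF lie] linear_coef]) simp
    show "linear_map T G (\<lambda>S. lie_bracket G (coef m S) y)"
      by (rule linear_map_comp[OF linear_coef bilinear_mapD(2)[OF G.bilinear_lie_bracket y]])
    show "coef m (lie_bracket RG (pure_tensor R G p x) (pure_tensor R G 1 y)) =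
        lie_bracket G (coef m (pure_tensor R G p x)) y" if "x \<in> carrier G" for p x
      using that y by (simp add: lie_bracket_pure_poly coef_pure
          linear_mapD(3)[OF bilinear_mapD(2)[OF G.bilinear_lie_bracket y]])
  qed
  have "\<exists>c. \<forall>x\<in>carrier G. coef m (d (pure_tensor R G p x)) = c \<odot>\<^bsub>G\<^esub> x" for p m
  proof -
    let ?f = "\<lambda>x. coef m (d (pure_tensor R G p x))"
    have "linear_map G G ?f"
      by (rule linear_map_comp[OF linear_map_comp[OF linear_pure_tensor_right lin] linear_coef]) simp
    moreover have "?f (lie_bracket G x y) = lie_bracket G (?f x) y"
      if "x \<in> carrier G" "y \<in> carrier G" for x y
      using d_lie[of "pure_tensor R G p x" "pure_tensor R G 1 y"] that
      by (simp add: lie_bracket_pure_poly coef_lie d_closed)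
    ultimately have "restrict ?f (carrier G) \<in> lie_centroid ring_of_type_algebra G"
      by (rule G.restrict_mem_lie_centroid)
    then obtain c where c: "restrict ?f (carrier G) = scalar c"
      unfolding central by blast
    have "?f x = c \<odot>\<^bsub>G\<^esub> x" if "x \<in> carrier G" for x
      using fun_cong[OF c, of x] that by simp
    then show ?thesis
      by blast
  qed
  note scalar = this
  \<comment> \<open>The scalar depends on \<open>p\<close> and \<open>m\<close> but not on x, so the
    same polynomial will serve for all x.\<close>
  define c where "c p m = (SOME c. \<forall>x\<in>carrier G. coef m (d (pure_tensor R G p x)) = c \<odot>\<^bsub>G\<^esub> x)"
    for p m
  have c: "coef m (d (pure_tensor R G p x)) = c p m \<odot>\<^bsub>G\<^esub> x" if "x \<in> carrier G" for p m x
    using someI_ex[OF scalar[of m p]] that unfolding c_def by blast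
  define u where "u = lie_bracket G x\<^sub>0 y\<^sub>0"
  have u: "u \<in> carrier G" "u \<noteq> \<zero>\<^bsub>G\<^esub>"
    using xy by (simp_all add: u_def)
  \<comment> \<open>This has the intended coefficients only if \<open>c p\<close> has finite
    support. That holds because d(p \<otimes> u) has finitely many nonzero coefficients c u and
    \<open>u\<close> is nonzero.\<close>
  define q where "q p = Poly_Mapping.Abs_poly_mapping (c p)" for p
  have lookup_q: "Poly_Mapping.lookup (q p) m = c p m" for p m
  proof -
    have "finite {m. c p m \<noteq> 0}"
      using finite_coef_support[of "d (pure_tensor R G p u)"] u
      by (simp add: c d_closed G.scale_eq_zero_iff)
    then show ?thesis
      by (simp add: q_def)
  qed
  have d_pure: "d (pure_tensor R G p x) = pure_tensor R G (q p) x" if "x \<in> carrier G" for p x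
    using that by (intro tensor_eqI) (simp_all add: d_closed c coef_pure lookup_q)
  have q: "q p = q 1 * p" for p
  proof (rule pure_tensor_cancel[OF u])
    show "pure_tensor R G (q p) u = pure_tensor R G (q 1 * p) u"
      \<comment> \<open>Here p \<otimes> u is the bracket of \<open>1 \<otimes> x\<^sub>0\<close>
        and \<open>p \<otimes> y\<^sub>0\<close>; applying d to its left argument leaves p as a
        factor on the right.\<close>
      using d_lie[of "pure_tensor R G 1 x\<^sub>0" "pure_tensor R G p y\<^sub>0"] xy
      by (simp add: lie_bracket_pure_poly d_pure u_def)
  qed
  have "d S = poly_mult (q 1) S" if "S \<in> carrier T" for S
    by (rule tensor_linear_map_eqI[OF lin linear_poly_mult A.vspace_axioms G.vspace_axioms _ that])
      (simp add: d_pure poly_mult_pure q[symmetric])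
  then have "d = restrict (poly_mult (q 1)) (carrier T)"
    using RG.lie_centroidD(2)[OF d] by (intro extensionalityI[of _ "carrier T"]) simp_all
  then show thesis
    by (rule that)
qed

end

text \<open>The two sides live on different carriers, so the equality is read through the canonical
  map \<open>tensor_endo\<close>: it is injective and its image is the whole Lie-centroid of R
  \<otimes> G.\<close>

theorem theorem6p11:
  fixes K :: "'k::{alg_closed_field, field_char_0} ring"
    and G :: "('k, 'g) module"
    and R :: "('k, ('x::finite \<Rightarrow>\<^sub>0 nat) \<Rightarrow>\<^sub>0 'k) module"
  defines "K \<equiv> ring_of_type_algebra"
    and "R \<equiv> polynomial_algebra"
  assumes leibniz: "leibniz_algebra K G"
    and gamma2: "gamma2_Lie K G \<noteq> {\<zero>\<^bsub>G\<^esub>}"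
    and centroid: "lie_centroid K G = {\<lambda>x\<in>carrier G. c \<odot>\<^bsub>G\<^esub> x | c. c \<in> carrier K}"
  shows "bij_betw (tensor_endo R G)
    (carrier (tensor_module R (lie_centroid_module K G)))
    (lie_centroid K (tensor_algebra R G))"
proof -
  interpret central_polynomial_tensor G "TYPE('x)"
    using leibniz_nonassoc_algebra[of G] leibniz centroid
    by (intro central_polynomial_tensor.intro polynomial_tensor.intro
        central_polynomial_tensor_axioms.intro) (simp_all add: K_def ring_of_type_algebra_def)
  obtain x y where xy: "x \<in> carrier G" "y \<in> carrier G" "lie_bracket G x y \<noteq> \<zero>\<^bsub>G\<^esub>"
    using gamma2_nontrivial leibniz gamma2 unfolding K_def by blast
  define u where "u = lie_bracket G x y"
  have u: "u \<in> carrier G" "u \<noteq> \<zero>\<^bsub>G\<^esub>"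
    using xy by (simp_all add: u_def)
  \<comment> \<open>Evaluating both multiplications at 1 \<otimes> u gives r \<otimes> u = s
    \<otimes> u, and \<open>u\<close> is nonzero.\<close>
  have inj: "r = s"
    if "restrict (poly_mult r) (carrier T) = restrict (poly_mult s) (carrier T)" for r s
  proof (rule pure_tensor_cancel[OF u])
    show "pure_tensor polynomial_algebra G r u = pure_tensor polynomial_algebra G s u"
      using fun_cong[OF that, of "pure_tensor polynomial_algebra G 1 u"] u
      by (simp add: poly_mult_pure)
  qed
  have surj: "d \<in> range (\<lambda>r. restrict (poly_mult r) (carrier T))"
    if "d \<in> lie_centroid ring_of_type_algebra RG" for d
    using lie_centroid_tensor_eq_poly_mult[OF that xy] by blast
  show ?thesis
    \<comment> \<open>With the domain written as the tensors r \<otimes> Id, the canonical map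
      becomes the assignment of \<open>poly_mult r\<close> to r.\<close>
    unfolding K_def R_def bij_betw_def carrier_tensor_centroid
    using inj surj poly_mult_mem_lie_centroid
    by (auto simp: inj_on_def image_image tensor_endo_scalar)
qed

end
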